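(* Let $K$ be a field with $\mathrm{char}(K)\neq 2,3$, let $\Delta\in K^*$, let $L=K[\delta]=K[T]/(T^2+3\Delta)$ be the resolvent algebra, and let $z\colon \mathcal{BC}(K;\Delta)\to L^*/L^{*3}$ be the Cardano invariant map. Then: (1) $z(g)\in (L^*/L^{*3})_{N=1}$ for all $g\in\mathcal{BC}(K;\Delta)$; (2) $z(g)=1$ if and only if $g$ is reducible over $K$ (i.e. has a linear factor in $K[X,Y]$); (3) $g_1,g_2\in\mathcal{BC}(K;\Delta)$ are $\mathrm{SL}(2,K)$-equivalent if and only if $z(g_1)=z(g_2)$; (4) $g_1,g_2\in\mathcal{BC}(K;\Delta)$ are $\mathrm{GL}(2,K)$-equivalent if and only if $z(g_1)=z(g_2)^{\pm1}$ (equivalently, $z(g_1)$ and $z(g_2)$ generate the same subgroup of $L^*/L^{*3}$); (5) $z$ induces a bijection between the set of $\mathrm{SL}(2,K)$-orbits on $\mathcal{BC}(K;\Delta)$ and the group $(L^*/L^{*3})_{N=1}$, and a bijection between the set of $\mathrm{GL}(2,K)$-orbits on $\mathcal{BC}(K;\Delta)$ and the set of cyclic subgroups of $(L^*/L^{*3})_{N=1}$.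
   Context: For a binary cubic form $g=aX^3+bX^2Y+cXY^2+dY^3\in K[X,Y]$ its discriminant is $\mathrm{disc}(g)=b^2c^2-4ac^3-4b^3d-27a^2d^2+18abcd$; $\mathcal{BC}(K;\Delta)$ is the set of binary cubic forms over $K$ with discriminant $\Delta$. Its cubic covariant is $G(X,Y)=(2b^3+27a^2d-9abc)X^3+3(b^2c+9abd-6ac^2)X^2Y-3(bc^2+9acd-6b^2d)XY^2-(2c^3+27ad^2-9bcd)Y^3$, and its Hessian is $H(X,Y)=(b^2-3ac)X^2+(bc-9ad)XY+(c^2-3bd)Y^2$. $\mathrm{GL}(2,K)$ acts (twisted action) by $g^M(X,Y)=\det(M)^{-1}g(rX+tY,sX+uY)$ for $M=\begin{pmatrix}r&s\\t&u\end{pmatrix}$; $g_1,g_2$ are $\mathrm{SL}(2,K)$- (resp. $\mathrm{GL}(2,K)$-) equivalent if $g_2=g_1^M$ for some $M$ in that group. In $L$, $\delta$ is the image of $T$ (so $\delta^2=-3\Delta$), fixed for all forms of discriminant $\Delta$; $L^*$ is its unit group and $\mathrm{N}_{L/K}(u+v\delta)=u^2+3\Delta v^2$. $(L^*/L^{*3})_{N=1}$ is the kernel of the induced norm homomorphism $L^*/L^{*3}\to K^*/K^{*3}$. The Cardano covariant is $C(X,Y)=\tfrac12(G(X,Y)+3\delta g(X,Y))\in L[X,Y]$, and the Cardano invariant $z(g)\in L^*/L^{*3}$ is the class of $C(x,y)$ for any $x,y\in K$ with $C(x,y)\in L^*$ (this class is independent of the choice). *)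

theory Defs
  imports
    "HOL-Analysis.Determinants"
    "HOL-Computational_Algebra.Polynomial"
    "HOL-Algebra.QuotRing"
    "HOL-Algebra.Elementary_Groups"
begin

section \<open>The resolvent algebra\<close>

definition type_ring :: "'r::comm_ring_1 ring" where
  "type_ring = \<lparr>carrier = UNIV, monoid.mult = (*), one = 1, zero = 0, add = (+)\<rparr>"

definition resolvent_ideal :: "'a::field \<Rightarrow> 'a poly set" where
  "resolvent_ideal \<Delta> = PIdl\<^bsub>type_ring\<^esub> [:3 * \<Delta>, 0, 1:]"

definition resolvent_algebra :: "'a::field \<Rightarrow> 'a poly set ring" where
  "resolvent_algebra \<Delta> = type_ring Quot resolvent_ideal \<Delta>"

definition res_of :: "'a::field \<Rightarrow> 'a \<Rightarrow> 'a poly set" where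
  "res_of \<Delta> c = resolvent_ideal \<Delta> +>\<^bsub>type_ring\<^esub> [:c:]"

definition res_delta :: "'a::field \<Rightarrow> 'a poly set" where
  "res_delta \<Delta> = resolvent_ideal \<Delta> +>\<^bsub>type_ring\<^esub> [:0, 1:]"

definition res_elem :: "'a::field \<Rightarrow> 'a \<Rightarrow> 'a \<Rightarrow> 'a poly set" where
  "res_elem \<Delta> u v =
     res_of \<Delta> u \<oplus>\<^bsub>resolvent_algebra \<Delta>\<^esub> res_of \<Delta> v \<otimes>\<^bsub>resolvent_algebra \<Delta>\<^esub> res_delta \<Delta>"

text \<open>The coordinates \<open>u\<close>, \<open>v\<close> of an element of the resolvent algebra are unique; see
  \<open>res_elem_inject\<close> and \<open>res_norm_res_elem\<close> below.\<close>

definition res_norm :: "'a::field \<Rightarrow> 'a poly set \<Rightarrow> 'a" where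
  "res_norm \<Delta> x = (THE n. \<exists>u v. x = res_elem \<Delta> u v \<and> n = u\<^sup>2 + 3 * \<Delta> * v\<^sup>2)"

definition cubes :: "('b, 'c) monoid_scheme \<Rightarrow> 'b set" where
  "cubes G = (\<lambda>x. x [^]\<^bsub>G\<^esub> (3::nat)) ` carrier G"

definition mod_cubes :: "('b, 'c) monoid_scheme \<Rightarrow> 'b set monoid" where
  "mod_cubes G = G Mod cubes G"

definition cube_class :: "('b, 'c) monoid_scheme \<Rightarrow> 'b \<Rightarrow> 'b set" where
  "cube_class G x = cubes G #>\<^bsub>G\<^esub> x"

definition res_units :: "'a::field \<Rightarrow> 'a poly set monoid" where
  "res_units \<Delta> = units_of (resolvent_algebra \<Delta>)"

definition field_units :: "'a::field monoid" where
  "field_units = units_of type_ring"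

definition norm_mod_cubes :: "'a::field \<Rightarrow> 'a poly set set \<Rightarrow> 'a set" where
  "norm_mod_cubes \<Delta> A = the_elem ((\<lambda>x. cube_class field_units (res_norm \<Delta> x)) ` A)"

definition norm_one_group :: "'a::field \<Rightarrow> 'a poly set set monoid" where
  "norm_one_group \<Delta> = (mod_cubes (res_units \<Delta>))
     \<lparr>carrier := kernel (mod_cubes (res_units \<Delta>)) (mod_cubes (field_units :: 'a monoid))
                  (norm_mod_cubes \<Delta>)\<rparr>"

definition cyclic_subgroups :: "('b, 'c) monoid_scheme \<Rightarrow> 'b set set" where
  "cyclic_subgroups G = {S. subgroup S G \<and> cyclic_group (G\<lparr>carrier := S\<rparr>)}"


section \<open>Binary cubic forms\<close>

text \<open>\<open>K[X,Y]\<close> is rendered as \<open>K[X][Y]\<close>: the inner variable of \<^typ>\<open>'a poly poly\<close> is \<open>X\<close>, the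
  outer one is \<open>Y\<close>.\<close>

definition bconst :: "'a::field \<Rightarrow> 'a poly poly" where
  "bconst c = [:[:c:]:]"

definition bX :: "'a::field poly poly" where
  "bX = [:[:0, 1:]:]"

definition bY :: "'a::field poly poly" where
  "bY = [:0, 1:]"

definition bsubst :: "'a::field poly poly \<Rightarrow> 'a poly poly \<Rightarrow> 'a poly poly \<Rightarrow> 'a poly poly" where
  "bsubst f P Q = poly (map_poly (\<lambda>p. poly (map_poly bconst p) P) f) Q"

definition beval :: "'a::field poly poly \<Rightarrow> 'a \<Rightarrow> 'a \<Rightarrow> 'a" where
  "beval f x y = poly (poly f [:y:]) x"

definition cubic_form :: "'a::field \<Rightarrow> 'a \<Rightarrow> 'a \<Rightarrow> 'a \<Rightarrow> 'a poly poly" where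
  "cubic_form a b c d =
     bconst a * bX ^ 3 + bconst b * bX ^ 2 * bY + bconst c * bX * bY ^ 2 + bconst d * bY ^ 3"

definition binary_cubic_forms :: "'a::field poly poly set" where
  "binary_cubic_forms = {cubic_form a b c d | a b c d. True}"

definition coeff_XY :: "'a::field poly poly \<Rightarrow> nat \<Rightarrow> nat \<Rightarrow> 'a" where
  "coeff_XY f i j = poly.coeff (poly.coeff f j) i"

definition cubic_disc :: "'a::field poly poly \<Rightarrow> 'a" where
  "cubic_disc g =
     (let a = coeff_XY g 3 0; b = coeff_XY g 2 1; c = coeff_XY g 1 2; d = coeff_XY g 0 3
      in b\<^sup>2 * c\<^sup>2 - 4 * a * c ^ 3 - 4 * b ^ 3 * d - 27 * a\<^sup>2 * d\<^sup>2 + 18 * a * b * c * d)"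

definition cubic_covariant :: "'a::field poly poly \<Rightarrow> 'a poly poly" where
  "cubic_covariant g =
     (let a = coeff_XY g 3 0; b = coeff_XY g 2 1; c = coeff_XY g 1 2; d = coeff_XY g 0 3
      in cubic_form
           (2 * b ^ 3 + 27 * a\<^sup>2 * d - 9 * a * b * c)
           (3 * (b\<^sup>2 * c + 9 * a * b * d - 6 * a * c\<^sup>2))
           (- 3 * (b * c\<^sup>2 + 9 * a * c * d - 6 * b\<^sup>2 * d))
           (- (2 * c ^ 3 + 27 * a * d\<^sup>2 - 9 * b * c * d)))"

definition BC :: "'a::field \<Rightarrow> 'a poly poly set" where
  "BC \<Delta> = {g \<in> binary_cubic_forms. cubic_disc g = \<Delta>}"

definition has_linear_factor :: "'a::field poly poly \<Rightarrow> bool" where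
  "has_linear_factor g \<longleftrightarrow>
     (\<exists>p q. (p, q) \<noteq> (0, 0) \<and> (bconst p * bX + bconst q * bY) dvd g)"

definition twisted_act :: "'a::field poly poly \<Rightarrow> 'a^2^2 \<Rightarrow> 'a poly poly" where
  "twisted_act g M =
     bconst (inverse (det M)) *
       bsubst g (bconst (M $ 1 $ 1) * bX + bconst (M $ 2 $ 1) * bY)
                (bconst (M $ 1 $ 2) * bX + bconst (M $ 2 $ 2) * bY)"

definition GL2 :: "('a::field^2^2) set" where
  "GL2 = {M. invertible M}"

definition SL2 :: "('a::field^2^2) set" where
  "SL2 = {M. det M = 1}"

definition form_equiv :: "('a::field^2^2) set \<Rightarrow> 'a poly poly \<Rightarrow> 'a poly poly \<Rightarrow> bool" where
  "form_equiv S g1 g2 \<longleftrightarrow> (\<exists>M\<in>S. g2 = twisted_act g1 M)"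

text \<open>The twisted action multiplies the discriminant by \<open>(det M)\<^sup>2\<close>, so GL(2) does not preserve
  \<open>BC \<Delta>\<close>.  Orbits on \<open>BC \<Delta>\<close> are therefore the classes of the equivalence relation restricted
  to \<open>BC \<Delta>\<close>.\<close>

definition orbits_on_BC :: "('a::field^2^2) set \<Rightarrow> 'a \<Rightarrow> 'a poly poly set set" where
  "orbits_on_BC S \<Delta> = BC \<Delta> // {(g1, g2). g1 \<in> BC \<Delta> \<and> g2 \<in> BC \<Delta> \<and> form_equiv S g1 g2}"


section \<open>The Cardano invariant\<close>

definition cardano_covariant :: "'a::field \<Rightarrow> 'a poly poly \<Rightarrow> 'a \<Rightarrow> 'a \<Rightarrow> 'a poly set" where
  "cardano_covariant \<Delta> g x y =
     res_of \<Delta> (1 / 2) \<otimes>\<^bsub>resolvent_algebra \<Delta>\<^esub>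
       (res_of \<Delta> (beval (cubic_covariant g) x y) \<oplus>\<^bsub>resolvent_algebra \<Delta>\<^esub>
        res_of \<Delta> 3 \<otimes>\<^bsub>resolvent_algebra \<Delta>\<^esub> res_delta \<Delta> \<otimes>\<^bsub>resolvent_algebra \<Delta>\<^esub> res_of \<Delta> (beval g x y))"

definition cardano_invariant :: "'a::field \<Rightarrow> 'a poly poly \<Rightarrow> 'a poly set set" where
  "cardano_invariant \<Delta> g =
     (THE w. \<exists>x y. cardano_covariant \<Delta> g x y \<in> Units (resolvent_algebra \<Delta>) \<and>
                   w = cube_class (res_units \<Delta>) (cardano_covariant \<Delta> g x y))"


section \<open>Basic facts\<close>

lemma type_ring_simps [simp]:
  "carrier type_ring = UNIV" "x \<otimes>\<^bsub>type_ring\<^esub> y = x * y" "x \<oplus>\<^bsub>type_ring\<^esub> y = x + y"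
  "\<one>\<^bsub>type_ring\<^esub> = 1" "\<zero>\<^bsub>type_ring\<^esub> = 0"
  by (simp_all add: type_ring_def)

lemma cring_type_ring: "cring (type_ring :: 'r::comm_ring_1 ring)"
proof (rule cringI)
  show "abelian_group (type_ring :: 'r ring)"
    by (rule abelian_groupI) (auto simp: algebra_simps intro: exI[of _ "- x" for x])
  show "comm_monoid (type_ring :: 'r ring)"
    by (rule comm_monoidI) (auto simp: algebra_simps)
qed (auto simp: algebra_simps)

lemma resolvent_ideal_iff: "p \<in> resolvent_ideal \<Delta> \<longleftrightarrow> [:3 * \<Delta>, 0, 1:] dvd p"
  by (auto simp: resolvent_ideal_def cgenideal_def dvd_def mult.commute)

lemma ideal_resolvent_ideal: "ideal (resolvent_ideal \<Delta>) type_ring"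
  unfolding resolvent_ideal_def by (rule cring.cgenideal_ideal[OF cring_type_ring]) simp

lemma cring_resolvent_algebra: "cring (resolvent_algebra \<Delta>)"
  unfolding resolvent_algebra_def
  by (rule ideal.quotient_is_cring[OF ideal_resolvent_ideal cring_type_ring])

lemma res_coset_eq_iff:
  "resolvent_ideal \<Delta> +>\<^bsub>type_ring\<^esub> p = resolvent_ideal \<Delta> +>\<^bsub>type_ring\<^esub> q
     \<longleftrightarrow> [:3 * \<Delta>, 0, 1:] dvd p - q"
proof -
  have eq: "resolvent_ideal \<Delta> +>\<^bsub>type_ring\<^esub> r = {s. [:3 * \<Delta>, 0, 1:] dvd s - r}" for r
  proof -
    have "s = (s - r) + r" for s :: "'a poly" by simp
    then show ?thesis
      by (auto simp: a_r_coset_def' resolvent_ideal_iff)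
  qed
  show ?thesis
  proof
    assume "resolvent_ideal \<Delta> +>\<^bsub>type_ring\<^esub> p = resolvent_ideal \<Delta> +>\<^bsub>type_ring\<^esub> q"
    moreover have "p \<in> resolvent_ideal \<Delta> +>\<^bsub>type_ring\<^esub> p" by (simp add: eq)
    ultimately show "[:3 * \<Delta>, 0, 1:] dvd p - q" by (simp add: eq)
  next
    assume pq: "[:3 * \<Delta>, 0, 1:] dvd p - q"
    have "[:3 * \<Delta>, 0, 1:] dvd s - p \<longleftrightarrow> [:3 * \<Delta>, 0, 1:] dvd s - q" for s
    proof -
      have "s - q = (s - p) + (p - q)" by simp
      then show ?thesis using pq dvd_add_left_iff by metis
    qed
    then show "resolvent_ideal \<Delta> +>\<^bsub>type_ring\<^esub> p = resolvent_ideal \<Delta> +>\<^bsub>type_ring\<^esub> q"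
      by (simp add: eq)
  qed
qed

lemma res_coset_add:
  "(resolvent_ideal \<Delta> +>\<^bsub>type_ring\<^esub> p) \<oplus>\<^bsub>resolvent_algebra \<Delta>\<^esub> (resolvent_ideal \<Delta> +>\<^bsub>type_ring\<^esub> q)
     = resolvent_ideal \<Delta> +>\<^bsub>type_ring\<^esub> (p + q)"
  using abelian_subgroup.a_rcos_sum[OF abelian_subgroupI3[OF ideal.axioms(1)[OF ideal_resolvent_ideal]],
      of p q] ring.is_abelian_group[OF cring.axioms(1)[OF cring_type_ring]]
  by (simp add: resolvent_algebra_def FactRing_def)

lemma res_coset_mult:
  "(resolvent_ideal \<Delta> +>\<^bsub>type_ring\<^esub> p) \<otimes>\<^bsub>resolvent_algebra \<Delta>\<^esub> (resolvent_ideal \<Delta> +>\<^bsub>type_ring\<^esub> q)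
     = resolvent_ideal \<Delta> +>\<^bsub>type_ring\<^esub> (p * q)"
  using ideal.rcoset_mult_add[OF ideal_resolvent_ideal, of p q]
  by (simp add: resolvent_algebra_def FactRing_def)

lemma res_elem_coset: "res_elem \<Delta> u v = resolvent_ideal \<Delta> +>\<^bsub>type_ring\<^esub> [:u, v:]"
  by (simp add: res_elem_def res_of_def res_delta_def res_coset_add res_coset_mult)

lemma res_elem_inject: "res_elem \<Delta> u v = res_elem \<Delta> u' v' \<longleftrightarrow> u = u' \<and> v = v'"
proof
  assume "res_elem \<Delta> u v = res_elem \<Delta> u' v'"
  then have d: "[:3 * \<Delta>, 0, 1:] dvd [:u - u', v - v':]"
    by (simp add: res_elem_coset res_coset_eq_iff)
  have "[:u - u', v - v':] = 0"
  proof (rule ccontr)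
    assume "[:u - u', v - v':] \<noteq> 0"
    from dvd_imp_degree_le[OF d this] show False by (simp split: if_splits)
  qed
  then show "u = u' \<and> v = v'" by simp
qed auto

lemma carrier_resolvent_algebra:
  "carrier (resolvent_algebra \<Delta>) = {res_elem \<Delta> u v | u v. True}"
proof -
  have "\<exists>u v. resolvent_ideal \<Delta> +>\<^bsub>type_ring\<^esub> p = res_elem \<Delta> u v" for p
  proof -
    let ?m = "[:3 * \<Delta>, 0, 1:]"
    define r where "r = p mod ?m"
    have "degree r < 2" using degree_mod_less'[of ?m p] by (cases "r = 0") (auto simp: r_def)
    then have r: "r = [:poly.coeff r 0, poly.coeff r 1:]"
      by (auto simp: poly_eq_iff coeff_pCons coeff_eq_0 split: nat.splits)
    have "?m dvd p - r" by (simp add: r_def)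
    then show ?thesis using r res_coset_eq_iff res_elem_coset by metis
  qed
  then show ?thesis
    by (auto simp: resolvent_algebra_def FactRing_def A_RCOSETS_def' res_elem_coset)
qed

lemma res_elem_mult:
  "res_elem \<Delta> u v \<otimes>\<^bsub>resolvent_algebra \<Delta>\<^esub> res_elem \<Delta> u' v' =
     res_elem \<Delta> (u * u' - 3 * \<Delta> * v * v') (u * v' + v * u')"
proof -
  have "[:u, v:] * [:u', v':] - [:u * u' - 3 * \<Delta> * v * v', u * v' + v * u':]
          = [:3 * \<Delta>, 0, 1:] * [:v * v':]"
    by (simp add: algebra_simps)
  then show ?thesis
    unfolding res_elem_coset res_coset_mult res_coset_eq_iff by (metis dvd_triv_left)
qed

lemma res_norm_res_elem: "res_norm \<Delta> (res_elem \<Delta> u v) = u\<^sup>2 + 3 * \<Delta> * v\<^sup>2"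
  unfolding res_norm_def by (rule the_equality) (auto simp: res_elem_inject)

lemma coeff_XY_cubic_form:
  "coeff_XY (cubic_form a b c d) 3 0 = a" "coeff_XY (cubic_form a b c d) 2 1 = b"
  "coeff_XY (cubic_form a b c d) 1 2 = c" "coeff_XY (cubic_form a b c d) 0 3 = d"
  by (simp_all add: coeff_XY_def cubic_form_def bconst_def bX_def bY_def power2_eq_square
      power3_eq_cube coeff_pCons eval_nat_numeral)

lemma beval_cubic_form:
  "beval (cubic_form a b c d) x y = a * x ^ 3 + b * x ^ 2 * y + c * x * y ^ 2 + d * y ^ 3"
  by (simp add: beval_def cubic_form_def bconst_def bX_def bY_def algebra_simps)

lemma bsubst_cubic_form:
  "bsubst (cubic_form a b c d) P Q =
     bconst a * P ^ 3 + bconst b * P ^ 2 * Q + bconst c * P * Q ^ 2 + bconst d * Q ^ 3"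
proof -
  have f: "cubic_form a b c d = [:[:0,0,0,a:], [:0,0,b:], [:0,c:], [:d:]:]"
    by (simp add: cubic_form_def bconst_def bX_def bY_def power2_eq_square power3_eq_cube)
  have [simp]: "bconst 0 = 0" by (simp add: bconst_def)
  show ?thesis
    by (simp add: f bsubst_def map_poly_pCons algebra_simps power2_eq_square power3_eq_cube)
qed

lemma cardano_covariant_res_elem:
  "cardano_covariant \<Delta> g x y =
     res_elem \<Delta> (beval (cubic_covariant g) x y / 2) (3 * beval g x y / 2)"
  by (simp add: cardano_covariant_def res_elem_coset res_of_def res_delta_def
      res_coset_add res_coset_mult mult.commute)

end

theory Submission
  imports Defs
begin

text \<open>
  Write \<open>C\<close> for the Cardano covariant. It satisfies \<open>N(C) = H\<^sup>3\<close> by the classical syzygy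
  \<open>G\<^sup>2 + 27 \<Delta> g\<^sup>2 = 4 H\<^sup>3\<close>, it is invariant under \<open>SL\<^sub>2\<close>, and a substitution of determinant \<open>-1\<close>
  conjugates it. Moving a point with \<open>H \<noteq> 0\<close> to \<open>(1, 0)\<close> and removing the middle term of \<open>H\<close> by a
  shear brings every form into a normal form whose Cardano covariant is \<open>\<zeta>(x + k\<delta>y)\<^sup>3\<close> with
  \<open>8 k\<^sup>3 N(\<zeta>) = 1\<close>. Hence \<open>C\<close> has only one class modulo cubes; multiplying \<open>\<zeta>\<close> by a cube \<open>\<epsilon>\<^sup>3\<close>
  amounts to an explicit \<open>SL\<^sub>2\<close> substitution, so this class determines the \<open>SL\<^sub>2\<close>-orbit, and every
  \<open>\<zeta>\<close> whose norm is a cube occurs. Two \<open>GL\<^sub>2\<close>-equivalent forms of equal discriminant differ by a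
  substitution of determinant \<open>\<plusminus>1\<close>, and conjugation inverts the class because \<open>N(C)\<close> is a cube.
  A form with a root has, after moving the root to \<open>(1, 0)\<close>, \<open>C(1, 0) = b\<^sup>3\<close>; conversely the normal
  form of the trivial class vanishes at \<open>(1, 0)\<close>.
\<close>


section \<open>Groups modulo cubes\<close>

context comm_group
begin

lemma subgroup_cubes: "subgroup (cubes G) G"
proof
  show "cubes G \<subseteq> carrier G" by (auto simp: cubes_def)
  show "x \<otimes> y \<in> cubes G" if xy: "x \<in> cubes G" "y \<in> cubes G" for x y
  proof -
    obtain a b where "a \<in> carrier G" "b \<in> carrier G" "x = a [^] (3::nat)" "y = b [^] (3::nat)"
      using xy by (auto simp: cubes_def)
    then have "x \<otimes> y = (a \<otimes> b) [^] (3::nat)" "a \<otimes> b \<in> carrier G"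
      by (simp_all add: nat_pow_distrib)
    then show ?thesis by (auto simp: cubes_def)
  qed
  show "\<one> \<in> cubes G"
    unfolding cubes_def by (rule image_eqI[of _ _ \<one>]) simp_all
  show "inv x \<in> cubes G" if "x \<in> cubes G" for x
    using that by (auto simp: cubes_def simp flip: nat_pow_inv)
qed

lemma comm_group_mod_cubes: "comm_group (mod_cubes G)"
  unfolding mod_cubes_def by (rule abelian_FactGroup[OF subgroup_cubes])

lemma carrier_mod_cubes: "carrier (mod_cubes G) = cube_class G ` carrier G"
  by (auto simp: mod_cubes_def cube_class_def carrier_FactGroup)

lemma cube_class_mult:
  assumes "x \<in> carrier G" "y \<in> carrier G"
  shows "cube_class G x \<otimes>\<^bsub>mod_cubes G\<^esub> cube_class G y = cube_class G (x \<otimes> y)"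
  using normal.rcos_sum[OF normal_iff_subgroup[THEN iffD2, OF subgroup_cubes] assms]
  by (simp add: mod_cubes_def cube_class_def)

lemma one_mod_cubes: "\<one>\<^bsub>mod_cubes G\<^esub> = cube_class G \<one>"
  by (simp add: mod_cubes_def cube_class_def coset_mult_one subgroup.subset[OF subgroup_cubes])

lemma mem_cube_class: "y \<in> cube_class G x \<longleftrightarrow> (\<exists>e\<in>carrier G. y = e [^] (3::nat) \<otimes> x)"
  by (auto simp: cube_class_def cubes_def r_coset_def)

lemma cube_class_eq_iff:
  assumes "x \<in> carrier G" "y \<in> carrier G"
  shows "cube_class G x = cube_class G y \<longleftrightarrow> (\<exists>e\<in>carrier G. x = y \<otimes> e [^] (3::nat))"
proof -
  have "cube_class G x = cube_class G y \<longleftrightarrow> x \<in> cube_class G y"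
    unfolding cube_class_def
    using repr_independence[OF _ assms(2) subgroup_cubes] rcos_self[OF assms(1) subgroup_cubes]
    by metis
  then show ?thesis
    using assms by (auto simp: mem_cube_class m_comm)
qed

text \<open>This exponent-three law is what lets "equal up to inversion" be restated as "generating
  the same subgroup".\<close>

lemma mod_cubes_cube:
  assumes "X \<in> carrier (mod_cubes G)"
  shows "X \<otimes>\<^bsub>mod_cubes G\<^esub> X \<otimes>\<^bsub>mod_cubes G\<^esub> X = \<one>\<^bsub>mod_cubes G\<^esub>"
proof -
  obtain x where x: "x \<in> carrier G" "X = cube_class G x"
    using assms by (auto simp: carrier_mod_cubes)
  have "x \<otimes> x \<otimes> x = \<one> \<otimes> x [^] (3::nat)"
    using x by (simp add: numeral_3_eq_3)
  then show ?thesis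
    using x by (auto simp: cube_class_mult one_mod_cubes cube_class_eq_iff)
qed

end

section \<open>Elements of exponent three and cyclic subgroups\<close>

context group
begin

text \<open>Exponent three makes the square of \<open>x\<close> its inverse, so the three listed
  elements, possibly all equal, are already closed.\<close>

lemma generate_singleton_exponent_three:
  assumes "x \<in> carrier G" "x \<otimes> x \<otimes> x = \<one>"
  shows "generate G {x} = {\<one>, x, inv x}"
proof (rule generateI[symmetric])
  have xx: "x \<otimes> x = inv x"
    using assms by (metis inv_equality m_closed m_assoc)
  then have ii: "inv x \<otimes> inv x = x"
    using assms by (metis inv_inv inv_mult_group)
  show "subgroup {\<one>, x, inv x} G"
    by (rule subgroupI) (use assms xx ii in auto)
  show "{x} \<subseteq> {\<one>, x, inv x}" by simp
  show "{\<one>, x, inv x} \<subseteq> K" if "subgroup K G" "{x} \<subseteq> K" for K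
    using that by (auto simp: subgroup.one_closed subgroup.m_inv_closed)
qed

lemma generate_eq_iff_exponent_three:
  assumes "x \<in> carrier G" "x \<otimes> x \<otimes> x = \<one>" "y \<in> carrier G" "y \<otimes> y \<otimes> y = \<one>"
  shows "generate G {x} = generate G {y} \<longleftrightarrow> x = y \<or> x = inv y"
proof -
  have "generate G {x} = {\<one>, x, inv x}" "generate G {y} = {\<one>, y, inv y}"
    using assms by (simp_all add: generate_singleton_exponent_three)
  moreover have "{\<one>, x, inv x} = {\<one>, y, inv y} \<longleftrightarrow> x = y \<or> x = inv y"
  proof
    assume eq: "{\<one>, x, inv x} = {\<one>, y, inv y}"
    then have "x = \<one> \<or> x = y \<or> x = inv y" by blast
    \<comment> \<open>Here the common set is trivial, which forces \<open>y\<close> to be trivial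
      too.\<close>
    moreover have "y = x" if "x = \<one>"
    proof -
      have "y \<in> {\<one>, x, inv x}" unfolding eq by simp
      with that show ?thesis by auto
    qed
    ultimately show "x = y \<or> x = inv y" by blast
  qed (use assms in auto)
  ultimately show ?thesis by simp
qed

text \<open>The library calls a group cyclic when it is generated within its own carrier; generation
  inside a subgroup agrees with generation in the ambient group. The image form is what the orbit
  bijection needs.\<close>

lemma cyclic_subgroups_eq:
  "cyclic_subgroups G = (\<lambda>x. generate G {x}) ` carrier G"
proof (intro equalityI subsetI)
  fix S assume "S \<in> cyclic_subgroups G"
  then have S: "subgroup S G" and "cyclic_group (G\<lparr>carrier := S\<rparr>)"
    by (auto simp: cyclic_subgroups_def)
  then obtain x where x: "x \<in> S" "subgroup_generated (G\<lparr>carrier := S\<rparr>) {x} = G\<lparr>carrier := S\<rparr>"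
    by (auto simp: cyclic_group_def)
  then have "carrier (subgroup_generated (G\<lparr>carrier := S\<rparr>) {x}) = S" by simp
  then have "generate (G\<lparr>carrier := S\<rparr>) {x} = S"
    using x(1) by (simp add: carrier_subgroup_generated)
  then have "generate G {x} = S"
    using generate_consistent[of "{x}" S] x S by simp
  then show "S \<in> (\<lambda>x. generate G {x}) ` carrier G"
    using x S by (auto dest: subgroup.mem_carrier)
next
  fix S assume "S \<in> (\<lambda>x. generate G {x}) ` carrier G"
  then obtain x where x: "x \<in> carrier G" "S = generate G {x}" by auto
  then have "subgroup_generated G {x} = G\<lparr>carrier := S\<rparr>"
    by (simp add: subgroup_generated_def)
  then have "cyclic_group (G\<lparr>carrier := S\<rparr>)"
    using cyclic_group_generated[of x] by simp
  then show "S \<in> cyclic_subgroups G"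
    using x generate_is_subgroup[of "{x}"] by (simp add: cyclic_subgroups_def)
qed

end


section \<open>The resolvent algebra\<close>

lemma res_one: "\<one>\<^bsub>resolvent_algebra \<Delta>\<^esub> = res_elem \<Delta> 1 0"
  by (simp add: resolvent_algebra_def FactRing_def res_elem_coset one_pCons)

lemma res_elem_in_carrier [simp]: "res_elem \<Delta> u v \<in> carrier (resolvent_algebra \<Delta>)"
  by (auto simp: carrier_resolvent_algebra)

lemma res_norm_mult:
  assumes "x \<in> carrier (resolvent_algebra \<Delta>)" "y \<in> carrier (resolvent_algebra \<Delta>)"
  shows "res_norm \<Delta> (x \<otimes>\<^bsub>resolvent_algebra \<Delta>\<^esub> y) = res_norm \<Delta> x * res_norm \<Delta> y"
  using assms
  by (auto simp: carrier_resolvent_algebra res_elem_mult res_norm_res_elem power2_eq_square algebra_simps)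

lemma res_norm_one [simp]: "res_norm \<Delta> \<one>\<^bsub>resolvent_algebra \<Delta>\<^esub> = 1"
  by (simp add: res_one res_norm_res_elem)

text \<open>For \<open>m\<close> the norm, the second factor is the inverse; for
  \<open>m = 1\<close> it is the conjugate. Both uses occur below.\<close>

lemma res_elem_mult_conj:
  "res_elem \<Delta> u v \<otimes>\<^bsub>resolvent_algebra \<Delta>\<^esub> res_elem \<Delta> (u / m) (- v / m)
     = res_elem \<Delta> ((u\<^sup>2 + 3 * \<Delta> * v\<^sup>2) / m) 0"
  by (simp add: res_elem_mult res_elem_inject power2_eq_square add_divide_distrib)

text \<open>Multiplicativity of the norm gives one direction, the conjugate divided by the norm the
  other. The argument also covers the case where the algebra is not a field.\<close>

lemma Units_resolvent_algebra:
  "x \<in> Units (resolvent_algebra \<Delta>) \<longleftrightarrow> x \<in> carrier (resolvent_algebra \<Delta>) \<and> res_norm \<Delta> x \<noteq> 0"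
proof
  assume x: "x \<in> Units (resolvent_algebra \<Delta>)"
  then obtain y where "x \<in> carrier (resolvent_algebra \<Delta>)" "y \<in> carrier (resolvent_algebra \<Delta>)"
    "x \<otimes>\<^bsub>resolvent_algebra \<Delta>\<^esub> y = \<one>\<^bsub>resolvent_algebra \<Delta>\<^esub>"
    by (auto simp: Units_def)
  moreover from this have "res_norm \<Delta> x * res_norm \<Delta> y = 1"
    by (metis res_norm_mult res_norm_one)
  ultimately show "x \<in> carrier (resolvent_algebra \<Delta>) \<and> res_norm \<Delta> x \<noteq> 0"
    by auto
next
  assume x: "x \<in> carrier (resolvent_algebra \<Delta>) \<and> res_norm \<Delta> x \<noteq> 0"
  then obtain u v where uv: "x = res_elem \<Delta> u v" by (auto simp: carrier_resolvent_algebra)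
  let ?m = "u\<^sup>2 + 3 * \<Delta> * v\<^sup>2"
  let ?y = "res_elem \<Delta> (u / ?m) (- v / ?m)"
  interpret L: cring "resolvent_algebra \<Delta>" by (rule cring_resolvent_algebra)
  have xy: "x \<otimes>\<^bsub>resolvent_algebra \<Delta>\<^esub> ?y = \<one>\<^bsub>resolvent_algebra \<Delta>\<^esub>"
    using x unfolding uv res_elem_mult_conj by (simp add: res_norm_res_elem res_one)
  moreover from this have "?y \<otimes>\<^bsub>resolvent_algebra \<Delta>\<^esub> x = \<one>\<^bsub>resolvent_algebra \<Delta>\<^esub>"
    using x by (simp add: L.m_comm)
  ultimately show "x \<in> Units (resolvent_algebra \<Delta>)"
    using x unfolding Units_def by (auto intro!: bexI[of _ ?y])
qed

lemma comm_group_res_units: "comm_group (res_units \<Delta>)"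
proof -
  interpret L: cring "resolvent_algebra \<Delta>" by (rule cring_resolvent_algebra)
  show ?thesis unfolding res_units_def by (rule L.units_comm_group)
qed

lemma comm_group_field_units: "comm_group (field_units :: 'a::field monoid)"
proof -
  interpret K: cring "type_ring :: 'a ring" by (rule cring_type_ring)
  show ?thesis unfolding field_units_def by (rule K.units_comm_group)
qed

lemma mult_res_units [simp]: "x \<otimes>\<^bsub>res_units \<Delta>\<^esub> y = x \<otimes>\<^bsub>resolvent_algebra \<Delta>\<^esub> y"
  by (simp add: res_units_def units_of_mult)

lemma one_res_units: "\<one>\<^bsub>res_units \<Delta>\<^esub> = res_elem \<Delta> 1 0"
  by (simp add: res_units_def units_of_one res_one)

lemma carrier_res_units: "carrier (res_units \<Delta>) = {res_elem \<Delta> u v | u v. u\<^sup>2 + 3 * \<Delta> * v\<^sup>2 \<noteq> 0}"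
  by (auto simp: res_units_def units_of_carrier Units_resolvent_algebra carrier_resolvent_algebra
      res_norm_res_elem res_elem_inject)

lemma res_elem_in_res_units: "res_elem \<Delta> u v \<in> carrier (res_units \<Delta>) \<longleftrightarrow> u\<^sup>2 + 3 * \<Delta> * v\<^sup>2 \<noteq> 0"
  by (auto simp: carrier_res_units res_elem_inject)

lemma res_elem_cube:
  "res_elem \<Delta> u v [^]\<^bsub>res_units \<Delta>\<^esub> (3::nat)
     = res_elem \<Delta> (u ^ 3 - 9 * \<Delta> * u * v\<^sup>2) (3 * u\<^sup>2 * v - 3 * \<Delta> * v ^ 3)"
  by (simp add: numeral_3_eq_3 one_res_units res_elem_mult res_elem_inject)
     (simp add: power2_eq_square algebra_simps)

lemma res_cube_class_eq_iff:
  assumes "u\<^sup>2 + 3 * \<Delta> * v\<^sup>2 \<noteq> 0" "u'\<^sup>2 + 3 * \<Delta> * v'\<^sup>2 \<noteq> 0"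
  shows "cube_class (res_units \<Delta>) (res_elem \<Delta> u v) = cube_class (res_units \<Delta>) (res_elem \<Delta> u' v')
    \<longleftrightarrow> (\<exists>e f. e\<^sup>2 + 3 * \<Delta> * f\<^sup>2 \<noteq> 0 \<and>
          res_elem \<Delta> u v = res_elem \<Delta> u' v' \<otimes>\<^bsub>resolvent_algebra \<Delta>\<^esub>
            res_elem \<Delta> e f [^]\<^bsub>res_units \<Delta>\<^esub> (3::nat))"
proof -
  have "res_elem \<Delta> u v \<in> carrier (res_units \<Delta>)" "res_elem \<Delta> u' v' \<in> carrier (res_units \<Delta>)"
    using assms by (auto simp: res_elem_in_res_units)
  from comm_group.cube_class_eq_iff[OF comm_group_res_units this]
  show ?thesis by (auto simp: carrier_res_units)
qed

text \<open>The factorization itself shows that the left-hand element is a unit, so only the two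
  factors need nonzero norm.\<close>

lemma res_cube_class_eqI:
  assumes "u'\<^sup>2 + 3 * \<Delta> * v'\<^sup>2 \<noteq> 0" "e\<^sup>2 + 3 * \<Delta> * f\<^sup>2 \<noteq> 0"
    and eq: "res_elem \<Delta> u v = res_elem \<Delta> u' v' \<otimes>\<^bsub>resolvent_algebra \<Delta>\<^esub>
      res_elem \<Delta> e f [^]\<^bsub>res_units \<Delta>\<^esub> (3::nat)"
  shows "cube_class (res_units \<Delta>) (res_elem \<Delta> u v) = cube_class (res_units \<Delta>) (res_elem \<Delta> u' v')"
proof -
  interpret L: comm_group "res_units \<Delta>" by (rule comm_group_res_units)
  have *: "res_elem \<Delta> u' v' \<in> carrier (res_units \<Delta>)" "res_elem \<Delta> e f \<in> carrier (res_units \<Delta>)"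
    using assms by (simp_all add: res_elem_in_res_units)
  then have "res_elem \<Delta> u v \<in> carrier (res_units \<Delta>)"
    unfolding eq mult_res_units[symmetric] by (intro L.m_closed L.nat_pow_closed)
  from L.cube_class_eq_iff[OF this *(1)] show ?thesis
    using *(2) eq unfolding mult_res_units by blast
qed

section \<open>The norm modulo cubes and its kernel\<close>

lemma carrier_field_units: "carrier (field_units :: 'a::field monoid) = - {0}"
proof -
  have "\<exists>y. y * x = 1 \<and> x * y = 1" if "x \<noteq> 0" for x :: 'a
    using that by (intro exI[of _ "inverse x"]) simp
  then show ?thesis by (auto simp: field_units_def units_of_carrier Units_def)
qed

lemma mult_field_units [simp]: "x \<otimes>\<^bsub>field_units\<^esub> y = x * y"
  by (simp add: field_units_def units_of_mult)

lemma one_field_units [simp]: "\<one>\<^bsub>field_units\<^esub> = 1"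
  by (simp add: field_units_def units_of_one)

lemma pow_field_units [simp]: "x [^]\<^bsub>field_units\<^esub> (n::nat) = x ^ n"
  by (induction n) (simp_all add: mult.commute)

lemma res_norm_cube:
  assumes "x \<in> carrier (res_units \<Delta>)"
  shows "res_norm \<Delta> (x [^]\<^bsub>res_units \<Delta>\<^esub> (3::nat)) = res_norm \<Delta> x ^ 3"
proof -
  interpret L: comm_group "res_units \<Delta>" by (rule comm_group_res_units)
  have "carrier (res_units \<Delta>) \<subseteq> carrier (resolvent_algebra \<Delta>)"
    by (auto simp: carrier_res_units)
  then have "res_norm \<Delta> (y \<otimes>\<^bsub>res_units \<Delta>\<^esub> z) = res_norm \<Delta> y * res_norm \<Delta> z"
    if "y \<in> carrier (res_units \<Delta>)" "z \<in> carrier (res_units \<Delta>)" for y z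
    using that by (simp add: res_norm_mult subset_iff)
  then show ?thesis
    using assms by (simp add: numeral_3_eq_3 del: mult_res_units)
qed

text \<open>The induced norm is defined by \<open>the_elem\<close> on a coset, so the class of the
  norm must be constant there: changing \<open>x\<close> by a cube changes its norm by a
  cube.\<close>

lemma norm_mod_cubes_cube_class:
  assumes "x \<in> carrier (res_units \<Delta>)"
  shows "norm_mod_cubes \<Delta> (cube_class (res_units \<Delta>) x) = cube_class field_units (res_norm \<Delta> x)"
proof -
  interpret L: comm_group "res_units \<Delta>" by (rule comm_group_res_units)
  interpret K: comm_group "field_units :: 'a monoid" by (rule comm_group_field_units)
  have nz: "res_norm \<Delta> y \<in> carrier field_units \<and> y \<in> carrier (resolvent_algebra \<Delta>)"
    if "y \<in> carrier (res_units \<Delta>)" for y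
    using that by (auto simp: carrier_res_units carrier_field_units res_norm_res_elem)
  have "cube_class field_units (res_norm \<Delta> y) = cube_class field_units (res_norm \<Delta> x)"
    if "y \<in> cube_class (res_units \<Delta>) x" for y
  proof -
    obtain e where e: "e \<in> carrier (res_units \<Delta>)" "y = e [^]\<^bsub>res_units \<Delta>\<^esub> (3::nat) \<otimes>\<^bsub>res_units \<Delta>\<^esub> x"
      using \<open>y \<in> _\<close> by (auto simp: L.mem_cube_class)
    then have "y \<in> carrier (res_units \<Delta>)"
      using assms by (simp del: mult_res_units)
    moreover have "res_norm \<Delta> y = res_norm \<Delta> x \<otimes>\<^bsub>field_units\<^esub> res_norm \<Delta> e [^]\<^bsub>field_units\<^esub> (3::nat)"
      using e assms nz by (simp add: res_norm_mult res_norm_cube)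
    ultimately show ?thesis
      using nz assms e K.cube_class_eq_iff by blast
  qed
  moreover have "x \<in> cube_class (res_units \<Delta>) x"
    using assms L.mem_cube_class by (auto intro!: bexI[of _ "\<one>\<^bsub>res_units \<Delta>\<^esub>"] simp del: mult_res_units)
  ultimately show ?thesis
    unfolding norm_mod_cubes_def by (intro the_elem_image_unique) blast+
qed

text \<open>Trivial classes in the target are exactly the nonzero cubes. The condition
  \<open>n \<noteq> 0\<close> also ensures that the representative is a unit.\<close>

lemma carrier_norm_one_group:
  "carrier (norm_one_group \<Delta>) = {cube_class (res_units \<Delta>) (res_elem \<Delta> p q) | p q.
     \<exists>n. n \<noteq> 0 \<and> p\<^sup>2 + 3 * \<Delta> * q\<^sup>2 = n ^ 3}"
proof -
  interpret L: comm_group "res_units \<Delta>" by (rule comm_group_res_units)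
  interpret K: comm_group "field_units :: 'a monoid" by (rule comm_group_field_units)
  have "cube_class field_units m = \<one>\<^bsub>mod_cubes field_units\<^esub> \<longleftrightarrow> (\<exists>n. n \<noteq> 0 \<and> m = n ^ 3)"
    if "m \<noteq> 0" for m :: 'a
    using that K.cube_class_eq_iff[of m 1] by (auto simp: K.one_mod_cubes carrier_field_units)
  then have *: "norm_mod_cubes \<Delta> (cube_class (res_units \<Delta>) (res_elem \<Delta> p q)) = \<one>\<^bsub>mod_cubes field_units\<^esub>
      \<longleftrightarrow> (\<exists>n. n \<noteq> 0 \<and> p\<^sup>2 + 3 * \<Delta> * q\<^sup>2 = n ^ 3)"
    if "p\<^sup>2 + 3 * \<Delta> * q\<^sup>2 \<noteq> 0" for p q
    using that by (simp add: norm_mod_cubes_cube_class res_elem_in_res_units res_norm_res_elem)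
  show ?thesis
  proof (intro equalityI subsetI)
    fix z assume "z \<in> carrier (norm_one_group \<Delta>)"
    then obtain p q where "p\<^sup>2 + 3 * \<Delta> * q\<^sup>2 \<noteq> 0" "z = cube_class (res_units \<Delta>) (res_elem \<Delta> p q)"
      "norm_mod_cubes \<Delta> z = \<one>\<^bsub>mod_cubes field_units\<^esub>"
      by (auto simp: norm_one_group_def kernel_def L.carrier_mod_cubes carrier_res_units)
    then show "z \<in> {cube_class (res_units \<Delta>) (res_elem \<Delta> p q) | p q.
        \<exists>n. n \<noteq> 0 \<and> p\<^sup>2 + 3 * \<Delta> * q\<^sup>2 = n ^ 3}"
      using * by auto
  next
    fix z assume "z \<in> {cube_class (res_units \<Delta>) (res_elem \<Delta> p q) | p q.
        \<exists>n. n \<noteq> 0 \<and> p\<^sup>2 + 3 * \<Delta> * q\<^sup>2 = n ^ 3}"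
    then obtain p q n where pq: "z = cube_class (res_units \<Delta>) (res_elem \<Delta> p q)"
      "n \<noteq> 0" "p\<^sup>2 + 3 * \<Delta> * q\<^sup>2 = n ^ 3"
      by auto
    moreover from this have "p\<^sup>2 + 3 * \<Delta> * q\<^sup>2 \<noteq> 0" by simp
    ultimately show "z \<in> carrier (norm_one_group \<Delta>)"
      using * by (auto simp: norm_one_group_def kernel_def L.carrier_mod_cubes res_elem_in_res_units)
  qed
qed

lemma subgroup_norm_one_group:
  "subgroup (carrier (norm_one_group \<Delta>)) (mod_cubes (res_units \<Delta>))"
proof -
  interpret L: comm_group "res_units \<Delta>" by (rule comm_group_res_units)
  interpret K: comm_group "field_units :: 'a monoid" by (rule comm_group_field_units)
  interpret LM: comm_group "mod_cubes (res_units \<Delta>)" by (rule L.comm_group_mod_cubes)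
  interpret KM: comm_group "mod_cubes (field_units :: 'a monoid)" by (rule K.comm_group_mod_cubes)
  have nz: "res_norm \<Delta> y \<in> carrier field_units \<and> y \<in> carrier (resolvent_algebra \<Delta>)"
    if "y \<in> carrier (res_units \<Delta>)" for y
    using that by (auto simp: carrier_res_units carrier_field_units res_norm_res_elem)
  have "norm_mod_cubes \<Delta> \<in> hom (mod_cubes (res_units \<Delta>)) (mod_cubes field_units)"
  proof (rule homI)
    fix X assume "X \<in> carrier (mod_cubes (res_units \<Delta>))"
    then show "norm_mod_cubes \<Delta> X \<in> carrier (mod_cubes field_units)"
      using nz by (auto simp: L.carrier_mod_cubes K.carrier_mod_cubes norm_mod_cubes_cube_class)
  next
    fix X Y assume "X \<in> carrier (mod_cubes (res_units \<Delta>))" "Y \<in> carrier (mod_cubes (res_units \<Delta>))"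
    then obtain x y where xy: "x \<in> carrier (res_units \<Delta>)" "y \<in> carrier (res_units \<Delta>)"
      "X = cube_class (res_units \<Delta>) x" "Y = cube_class (res_units \<Delta>) y"
      by (auto simp: L.carrier_mod_cubes)
    moreover from this have "x \<otimes>\<^bsub>res_units \<Delta>\<^esub> y \<in> carrier (res_units \<Delta>)" by (intro L.m_closed)
    moreover have "res_norm \<Delta> (x \<otimes>\<^bsub>res_units \<Delta>\<^esub> y) = res_norm \<Delta> x \<otimes>\<^bsub>field_units\<^esub> res_norm \<Delta> y"
      using xy nz by (simp add: res_norm_mult)
    ultimately show "norm_mod_cubes \<Delta> (X \<otimes>\<^bsub>mod_cubes (res_units \<Delta>)\<^esub> Y)
        = norm_mod_cubes \<Delta> X \<otimes>\<^bsub>mod_cubes field_units\<^esub> norm_mod_cubes \<Delta> Y"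
      using nz by (simp add: L.cube_class_mult K.cube_class_mult norm_mod_cubes_cube_class
          del: mult_res_units mult_field_units)
  qed
  then interpret N: group_hom "mod_cubes (res_units \<Delta>)" "mod_cubes (field_units :: 'a monoid)" "norm_mod_cubes \<Delta>"
    by unfold_locales
  show ?thesis
    using N.subgroup_kernel by (simp add: norm_one_group_def)
qed

text \<open>An element times its conjugate is its norm, here the cube of \<open>n\<close>;
  conjugation therefore inverts the class.\<close>

lemma inv_res_cube_class:
  assumes "n \<noteq> 0" "p\<^sup>2 + 3 * \<Delta> * q\<^sup>2 = n ^ 3"
  shows "inv\<^bsub>mod_cubes (res_units \<Delta>)\<^esub> (cube_class (res_units \<Delta>) (res_elem \<Delta> p q))
    = cube_class (res_units \<Delta>) (res_elem \<Delta> p (- q))"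
proof -
  interpret L: comm_group "res_units \<Delta>" by (rule comm_group_res_units)
  interpret LM: comm_group "mod_cubes (res_units \<Delta>)" by (rule L.comm_group_mod_cubes)
  have u: "res_elem \<Delta> p q \<in> carrier (res_units \<Delta>)" "res_elem \<Delta> p (- q) \<in> carrier (res_units \<Delta>)"
    using assms by (simp_all add: res_elem_in_res_units)
  have "res_elem \<Delta> p q \<otimes>\<^bsub>res_units \<Delta>\<^esub> res_elem \<Delta> p (- q) = res_elem \<Delta> (n ^ 3) 0"
    using assms(2) res_elem_mult_conj[of \<Delta> p q 1] by simp
  moreover have "cube_class (res_units \<Delta>) (res_elem \<Delta> (n ^ 3) 0) = cube_class (res_units \<Delta>) (res_elem \<Delta> 1 0)"
    using assms(1) by (intro res_cube_class_eqI[where e = n and f = 0]) (simp_all add: res_elem_cube res_elem_mult)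
  ultimately show ?thesis
    using u by (intro LM.comm_inv_char)
      (auto simp: L.carrier_mod_cubes L.cube_class_mult L.one_mod_cubes one_res_units simp del: mult_res_units)
qed


section \<open>Covariants of binary cubic forms\<close>

definition cubic_val :: "'a::comm_ring_1 \<Rightarrow> 'a \<Rightarrow> 'a \<Rightarrow> 'a \<Rightarrow> 'a \<Rightarrow> 'a \<Rightarrow> 'a" where
  "cubic_val a b c d x y = a * x ^ 3 + b * x\<^sup>2 * y + c * x * y\<^sup>2 + d * y ^ 3"

text \<open>The derivative of the cubic at \<open>(x, y)\<close> in the direction
  \<open>(z, w)\<close>. Such derivatives are the middle coefficients of a form after a linear
  substitution.\<close>

definition cubic_polar :: "'a::comm_ring_1 \<Rightarrow> 'a \<Rightarrow> 'a \<Rightarrow> 'a \<Rightarrow> 'a \<Rightarrow> 'a \<Rightarrow> 'a \<Rightarrow> 'a \<Rightarrow> 'a" where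
  "cubic_polar a b c d x y z w =
     (3 * a * x\<^sup>2 + 2 * b * x * y + c * y\<^sup>2) * z + (b * x\<^sup>2 + 2 * c * x * y + 3 * d * y\<^sup>2) * w"

definition disc_coeffs :: "'a::comm_ring_1 \<Rightarrow> 'a \<Rightarrow> 'a \<Rightarrow> 'a \<Rightarrow> 'a" where
  "disc_coeffs a b c d =
     b\<^sup>2 * c\<^sup>2 - 4 * a * c ^ 3 - 4 * b ^ 3 * d - 27 * a\<^sup>2 * d\<^sup>2 + 18 * a * b * c * d"

definition cov0 :: "'a::comm_ring_1 \<Rightarrow> 'a \<Rightarrow> 'a \<Rightarrow> 'a \<Rightarrow> 'a" where
  "cov0 a b c d = 2 * b ^ 3 + 27 * a\<^sup>2 * d - 9 * a * b * c"

definition cov1 :: "'a::comm_ring_1 \<Rightarrow> 'a \<Rightarrow> 'a \<Rightarrow> 'a \<Rightarrow> 'a" where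
  "cov1 a b c d = 3 * (b\<^sup>2 * c + 9 * a * b * d - 6 * a * c\<^sup>2)"

text \<open>Exchanging the two variables reverses the coefficients of the form and negates the cubic
  covariant, so its last two coefficients come from \<open>cov1\<close> and
  \<open>cov0\<close>.\<close>

abbreviation cov_val :: "'a::comm_ring_1 \<Rightarrow> 'a \<Rightarrow> 'a \<Rightarrow> 'a \<Rightarrow> 'a \<Rightarrow> 'a \<Rightarrow> 'a" where
  "cov_val a b c d \<equiv> cubic_val (cov0 a b c d) (cov1 a b c d) (- cov1 d c b a) (- cov0 d c b a)"

definition hess_val :: "'a::comm_ring_1 \<Rightarrow> 'a \<Rightarrow> 'a \<Rightarrow> 'a \<Rightarrow> 'a \<Rightarrow> 'a \<Rightarrow> 'a" where
  "hess_val a b c d x y =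
     (b\<^sup>2 - 3 * a * c) * x\<^sup>2 + (b * c - 9 * a * d) * x * y + (c\<^sup>2 - 3 * b * d) * y\<^sup>2"

section \<open>Polynomial identities for linear substitutions\<close>

context
  fixes a b c d r s t u :: "'a::idom"
begin

text \<open>The four coefficient arguments are those of the untwisted substitution by the rows
  \<open>(r, s)\<close> and \<open>(t, u)\<close>; the same pattern recurs in the next
  lemmas.\<close>

lemma cubic_val_subst:
  "cubic_val (cubic_val a b c d r s) (cubic_polar a b c d r s t u)
     (cubic_polar a b c d t u r s) (cubic_val a b c d t u) x y
   = cubic_val a b c d (r * x + t * y) (s * x + u * y)"
  unfolding cubic_val_def cubic_polar_def by Groebner_Basis.algebra

lemma cubic_polar_subst:
  "cubic_polar (cubic_val a b c d r s) (cubic_polar a b c d r s t u)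
     (cubic_polar a b c d t u r s) (cubic_val a b c d t u) x y z w
   = cubic_polar a b c d (r * x + t * y) (s * x + u * y) (r * z + t * w) (s * z + u * w)"
  unfolding cubic_val_def cubic_polar_def by Groebner_Basis.algebra

lemma disc_coeffs_subst:
  "disc_coeffs (cubic_val a b c d r s) (cubic_polar a b c d r s t u)
     (cubic_polar a b c d t u r s) (cubic_val a b c d t u)
   = (r * u - s * t) ^ 6 * disc_coeffs a b c d"
  unfolding disc_coeffs_def cubic_val_def cubic_polar_def by Groebner_Basis.algebra

lemma cov0_subst:
  "cov0 (cubic_val a b c d r s) (cubic_polar a b c d r s t u)
     (cubic_polar a b c d t u r s) (cubic_val a b c d t u)
   = (r * u - s * t) ^ 3 * cov_val a b c d r s"
  unfolding cov0_def cov1_def cubic_val_def cubic_polar_def by Groebner_Basis.algebra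

lemma cov1_subst:
  "cov1 (cubic_val a b c d r s) (cubic_polar a b c d r s t u)
     (cubic_polar a b c d t u r s) (cubic_val a b c d t u)
   = (r * u - s * t) ^ 3 *
       cubic_polar (cov0 a b c d) (cov1 a b c d) (- cov1 d c b a) (- cov0 d c b a) r s t u"
  unfolding cov0_def cov1_def cubic_val_def cubic_polar_def by Groebner_Basis.algebra

text \<open>After division by 4 this says that the norm of the Cardano covariant is the cube of the
  Hessian.\<close>

lemma cubic_syzygy:
  "(cov_val a b c d r s)\<^sup>2 + 27 * disc_coeffs a b c d * (cubic_val a b c d r s)\<^sup>2
   = 4 * hess_val a b c d r s ^ 3"
  unfolding disc_coeffs_def cov0_def cov1_def cubic_val_def hess_val_def by Groebner_Basis.algebra

end

lemma cov_val_subst: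
  fixes a b c d r s t u x y :: "'a::idom"
  shows "cov_val (cubic_val a b c d r s) (cubic_polar a b c d r s t u)
     (cubic_polar a b c d t u r s) (cubic_val a b c d t u) x y
   = (r * u - s * t) ^ 3 * cov_val a b c d (r * x + t * y) (s * x + u * y)"
proof -
  let ?e = "r * u - s * t"
  let ?A = "cov0 a b c d" and ?B = "cov1 a b c d" and ?C = "- cov1 d c b a" and ?D = "- cov0 d c b a"
  have "cov0 (cubic_val a b c d t u) (cubic_polar a b c d t u r s)
     (cubic_polar a b c d r s t u) (cubic_val a b c d r s) = - (?e ^ 3 * cubic_val ?A ?B ?C ?D t u)"
    unfolding cov0_subst by (simp add: power3_eq_cube algebra_simps)
  moreover have "cov1 (cubic_val a b c d t u) (cubic_polar a b c d t u r s)
     (cubic_polar a b c d r s t u) (cubic_val a b c d r s) = - (?e ^ 3 * cubic_polar ?A ?B ?C ?D t u r s)"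
    unfolding cov1_subst by (simp add: power3_eq_cube algebra_simps)
  moreover have "cubic_val (e * A) (e * B) (e * C) (e * D) x y = e * cubic_val A B C D x y"
    for e A B C D :: 'a
    by (simp add: cubic_val_def algebra_simps)
  ultimately show ?thesis
    unfolding cov0_subst cov1_subst minus_minus by (simp add: cubic_val_subst)
qed

lemma cubic_form_eq_pCons: "cubic_form a b c d = [:[:0,0,0,a:], [:0,0,b:], [:0,c:], [:d:]:]"
  by (simp add: cubic_form_def bconst_def bX_def bY_def power2_eq_square power3_eq_cube)

lemma cubic_disc_cubic_form: "cubic_disc (cubic_form a b c d) = disc_coeffs a b c d"
  unfolding cubic_disc_def coeff_XY_cubic_form Let_def disc_coeffs_def ..

lemma cubic_form_in_BC: "cubic_form a b c d \<in> BC \<Delta> \<longleftrightarrow> disc_coeffs a b c d = \<Delta>"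
  by (auto simp: BC_def binary_cubic_forms_def cubic_disc_cubic_form)

lemma BC_E:
  assumes "g \<in> BC \<Delta>"
  obtains a b c d where "g = cubic_form a b c d" "disc_coeffs a b c d = \<Delta>"
  using assms by (auto simp: BC_def binary_cubic_forms_def cubic_disc_cubic_form)

lemma beval_cubic: "beval (cubic_form a b c d) x y = cubic_val a b c d x y"
  by (simp add: beval_cubic_form cubic_val_def)

lemma cubic_covariant_cubic_form:
  "cubic_covariant (cubic_form a b c d) =
     cubic_form (cov0 a b c d) (cov1 a b c d) (- cov1 d c b a) (- cov0 d c b a)"
  unfolding cubic_covariant_def coeff_XY_cubic_form Let_def
  by (simp add: cubic_form_eq_pCons cov0_def cov1_def algebra_simps)

lemma cardano_covariant_cubic_form:
  "cardano_covariant \<Delta> (cubic_form a b c d) x y =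
     res_elem \<Delta> (cov_val a b c d x y / 2) (3 * cubic_val a b c d x y / 2)"
  by (simp add: cardano_covariant_res_elem cubic_covariant_cubic_form beval_cubic)

lemma twisted_act_cubic_form:
  assumes "M $ 1 $ 1 = r" "M $ 1 $ 2 = s" "M $ 2 $ 1 = t" "M $ 2 $ 2 = u" "det M = e"
  shows "twisted_act (cubic_form a b c d) M =
    cubic_form (inverse e * cubic_val a b c d r s) (inverse e * cubic_polar a b c d r s t u)
      (inverse e * cubic_polar a b c d t u r s) (inverse e * cubic_val a b c d t u)"
proof -
  have P: "bconst x * bX + bconst y * bY = [:[:0, x:], [:y:]:]" for x y :: 'a
    by (simp add: bconst_def bX_def bY_def)
  show ?thesis
    unfolding twisted_act_def assms bsubst_cubic_form P
    by (simp add: cubic_form_eq_pCons bconst_def power2_eq_square power3_eq_cube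
        cubic_val_def cubic_polar_def algebra_simps)
qed


section \<open>The twisted action\<close>

lemma cubic_val_scale: "cubic_val (e * a) (e * b) (e * c) (e * d) x y = e * cubic_val a b c d x y"
  by (simp add: cubic_val_def algebra_simps)

lemma cubic_polar_scale:
  "cubic_polar (e * a) (e * b) (e * c) (e * d) x y z w = e * cubic_polar a b c d x y z w"
  by (simp add: cubic_polar_def algebra_simps)

lemma disc_coeffs_scale: "disc_coeffs (e * a) (e * b) (e * c) (e * d) = e ^ 4 * disc_coeffs a b c d"
  for a :: "'a::idom"
  unfolding disc_coeffs_def by Groebner_Basis.algebra

lemma cov_val_scale: "cov_val (e * a) (e * b) (e * c) (e * d) x y = e ^ 3 * cov_val a b c d x y"
  for a :: "'a::idom"
  unfolding cov0_def cov1_def cubic_val_def by Groebner_Basis.algebra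

lemmas twisted_act_cubic_form' = twisted_act_cubic_form[OF refl refl refl refl refl]

text \<open>Substitution contributes the sixth power of the determinant, and the twist, through
  degree 4 in the coefficients, the inverse fourth power.\<close>

lemma cubic_disc_twisted_act:
  assumes "g \<in> binary_cubic_forms" "det M \<noteq> 0"
  shows "cubic_disc (twisted_act g M) = (det M)\<^sup>2 * cubic_disc g"
proof -
  obtain a b c d where g: "g = cubic_form a b c d"
    using assms by (auto simp: binary_cubic_forms_def)
  have "inverse (det M) ^ 4 * det M ^ 6 = (det M)\<^sup>2"
    using assms by (simp add: field_simps flip: power_add)
  then show ?thesis
    by (simp add: g twisted_act_cubic_form' cubic_disc_cubic_form disc_coeffs_scale
        disc_coeffs_subst det_2 flip: mult.assoc)
qed

lemma twisted_act_binary_cubic_forms: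
  "g \<in> binary_cubic_forms \<Longrightarrow> twisted_act g M \<in> binary_cubic_forms"
  by (simp add: binary_cubic_forms_def) (metis twisted_act_cubic_form')

lemma beval_twisted_act:
  assumes "g \<in> binary_cubic_forms"
  shows "beval (twisted_act g M) x y =
    inverse (det M) * beval g (M $ 1 $ 1 * x + M $ 2 $ 1 * y) (M $ 1 $ 2 * x + M $ 2 $ 2 * y)"
proof -
  obtain a b c d where g: "g = cubic_form a b c d"
    using assms by (auto simp: binary_cubic_forms_def)
  show ?thesis
    by (simp add: g twisted_act_cubic_form' beval_cubic cubic_val_scale cubic_val_subst)
qed

text \<open>The third power of the determinant from the substitution cancels against the twist,
  since the covariant is cubic in the coefficients.\<close>

lemma beval_cubic_covariant_twisted_act:
  assumes "g \<in> binary_cubic_forms" "det M \<noteq> 0"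
  shows "beval (cubic_covariant (twisted_act g M)) x y =
    beval (cubic_covariant g) (M $ 1 $ 1 * x + M $ 2 $ 1 * y) (M $ 1 $ 2 * x + M $ 2 $ 2 * y)"
proof -
  obtain a b c d where g: "g = cubic_form a b c d"
    using assms by (auto simp: binary_cubic_forms_def)
  have "inverse (det M) ^ 3 * det M ^ 3 = 1"
    using assms by (simp flip: power_mult_distrib)
  then show ?thesis
    unfolding g twisted_act_cubic_form' cubic_covariant_cubic_form beval_cubic cov_val_scale cov_val_subst
    by (simp add: det_2 flip: mult.assoc)
qed

text \<open>The condition on \<open>e\<close> means determinant 1 or -1. The covariant part is
  unchanged and the form is multiplied by \<open>e\<close>, so determinant -1 acts by
  conjugation.\<close>

lemma cardano_covariant_twisted_act:
  assumes "g \<in> binary_cubic_forms" "det M = e" "e * e = 1"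
  shows "cardano_covariant \<Delta> (twisted_act g M) x y =
    res_elem \<Delta> (beval (cubic_covariant g) (M $ 1 $ 1 * x + M $ 2 $ 1 * y) (M $ 1 $ 2 * x + M $ 2 $ 2 * y) / 2)
      (e * (3 * beval g (M $ 1 $ 1 * x + M $ 2 $ 1 * y) (M $ 1 $ 2 * x + M $ 2 $ 2 * y) / 2))"
proof -
  have "e \<noteq> 0" "inverse e = e" using assms(3) inverse_unique by auto
  then show ?thesis
    using assms by (simp add: cardano_covariant_res_elem beval_twisted_act
        beval_cubic_covariant_twisted_act mult.left_commute)
qed

lemma cardano_covariant_SL2:
  assumes "g \<in> binary_cubic_forms" "M \<in> SL2"
  shows "cardano_covariant \<Delta> (twisted_act g M) x y =
    cardano_covariant \<Delta> g (M $ 1 $ 1 * x + M $ 2 $ 1 * y) (M $ 1 $ 2 * x + M $ 2 $ 2 * y)"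
  using assms by (subst cardano_covariant_twisted_act) (auto simp: SL2_def cardano_covariant_res_elem)

text \<open>Points are row vectors multiplied by the matrix on the right, which explains the order
  of the product.\<close>

lemma twisted_act_twisted_act:
  assumes "g \<in> binary_cubic_forms"
  shows "twisted_act (twisted_act g M) N = twisted_act g (N ** M)"
proof -
  obtain a b c d where g: "g = cubic_form a b c d"
    using assms by (auto simp: binary_cubic_forms_def)
  have e: "(N ** M) $ i $ j = M $ 1 $ j * N $ i $ 1 + M $ 2 $ j * N $ i $ 2" for i j
    by (simp add: matrix_matrix_mult_def sum_2 mult.commute)
  show ?thesis
    unfolding g twisted_act_cubic_form' e
    by (simp add: cubic_val_scale cubic_polar_scale cubic_val_subst cubic_polar_subst det_mul
        mult.assoc)
qed

lemma form_equiv_trans: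
  assumes "form_equiv S g1 g2" "form_equiv S g2 g3" "g1 \<in> binary_cubic_forms"
    and "\<And>M N. M \<in> S \<Longrightarrow> N \<in> S \<Longrightarrow> N ** M \<in> S"
  shows "form_equiv S g1 g3"
  using assms unfolding form_equiv_def by (metis twisted_act_twisted_act)

lemma SL2_mult: "M \<in> SL2 \<Longrightarrow> N \<in> SL2 \<Longrightarrow> N ** M \<in> SL2"
  by (simp add: SL2_def det_mul)

lemmas form_equiv_SL2_trans = form_equiv_trans[OF _ _ _ SL2_mult]

lemma GL2_iff: "M \<in> GL2 \<longleftrightarrow> det M \<noteq> 0"
  by (simp add: GL2_def invertible_det_nz)

lemma GL2_mult: "M \<in> GL2 \<Longrightarrow> N \<in> GL2 \<Longrightarrow> N ** M \<in> GL2"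
  by (simp add: GL2_iff det_mul)

definition mat2 :: "'a::field \<Rightarrow> 'a \<Rightarrow> 'a \<Rightarrow> 'a \<Rightarrow> 'a^2^2" where
  "mat2 r s t u = vector [vector [r, s], vector [t, u]]"

lemma mat2_nth [simp]:
  "mat2 r s t u $ 1 $ 1 = r" "mat2 r s t u $ 1 $ 2 = s"
  "mat2 r s t u $ 2 $ 1 = t" "mat2 r s t u $ 2 $ 2 = u"
  by (simp_all add: mat2_def)

lemma det_mat2 [simp]: "det (mat2 r s t u) = r * u - s * t"
  by (simp add: det_2)

lemma twisted_act_mat_1: "g \<in> binary_cubic_forms \<Longrightarrow> twisted_act g (mat 1) = g"
  by (auto simp: binary_cubic_forms_def twisted_act_cubic_form' mat_def det_2 cubic_val_def cubic_polar_def)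

lemma form_equiv_SL2_sym:
  assumes "form_equiv SL2 g1 g2" "g1 \<in> binary_cubic_forms"
  shows "form_equiv SL2 g2 g1"
proof -
  obtain M where M: "det M = 1" "g2 = twisted_act g1 M"
    using assms by (auto simp: form_equiv_def SL2_def)
  \<comment> \<open>The adjugate of \<open>M\<close>, which is its inverse because the determinant
    is 1.\<close>
  define N where "N = mat2 (M $ 2 $ 2) (- (M $ 1 $ 2)) (- (M $ 2 $ 1)) (M $ 1 $ 1)"
  have "N ** M = mat 1"
    using M(1) by (simp add: vec_eq_iff forall_2 matrix_matrix_mult_def sum_2 mat_def N_def det_2 algebra_simps)
  moreover have "det N = 1"
    using M(1) by (simp add: N_def det_2 algebra_simps)
  ultimately show ?thesis
    using assms M unfolding form_equiv_def SL2_def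
    by (auto simp: twisted_act_twisted_act twisted_act_mat_1 intro!: bexI[of _ N])
qed

lemma cubic_form_SL2:
  assumes "r * u - s * t = 1"
  shows "form_equiv SL2 (cubic_form a b c d)
    (cubic_form (cubic_val a b c d r s) (cubic_polar a b c d r s t u)
       (cubic_polar a b c d t u r s) (cubic_val a b c d t u))"
  unfolding form_equiv_def using assms
  by (intro bexI[of _ "mat2 r s t u"]) (auto simp: SL2_def twisted_act_cubic_form')

text \<open>A matrix with first row \<open>(x, y)\<close> makes the value of a form at that point
  the value at \<open>(1, 0)\<close> of the transformed form.\<close>

lemma SL2_first_row:
  fixes x y :: "'a::field"
  assumes "x \<noteq> 0 \<or> y \<noteq> 0"
  obtains t u where "x * u - y * t = 1"
proof (cases "x = 0")
  case True
  then show ?thesis using assms that[of 0 "- inverse y"] by simp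
next
  case False
  then show ?thesis using that[of "inverse x" 0] by simp
qed


section \<open>Normal forms\<close>

text \<open>The form \<open>g\<close> with \<open>3\<delta>g/2\<close> the \<open>\<delta>\<close>-part of \<open>(p + 3w\<delta>)(x + k\<delta>y)\<^sup>3\<close>. The coefficient \<open>3w\<close> makes
  the coefficients of \<open>g\<close> free of denominators.\<close>

definition normal_form :: "'a::field \<Rightarrow> 'a \<Rightarrow> 'a \<Rightarrow> 'a \<Rightarrow> 'a poly poly" where
  "normal_form \<Delta> p w k =
     cubic_form (2 * w) (2 * k * p) (- 18 * \<Delta> * k\<^sup>2 * w) (- 2 * \<Delta> * k ^ 3 * p)"

text \<open>The discriminant is \<Delta> times the square of 8 \<open>k\<close>^3 N(\<zeta>), where
  \<zeta> = \<open>p\<close> + 3\<open>w\<close>\<delta>; the hypothesis normalizes that factor to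
  1.\<close>

lemma normal_form_in_BC:
  assumes "8 * k ^ 3 * (p\<^sup>2 + 27 * \<Delta> * w\<^sup>2) = 1"
  shows "normal_form \<Delta> p w k \<in> BC \<Delta>"
proof -
  have "disc_coeffs (2 * w) (2 * k * p) (- 18 * \<Delta> * k\<^sup>2 * w) (- 2 * \<Delta> * k ^ 3 * p)
      = \<Delta> * (8 * k ^ 3 * (p\<^sup>2 + 27 * \<Delta> * w\<^sup>2))\<^sup>2"
    unfolding disc_coeffs_def by Groebner_Basis.algebra
  then show ?thesis
    using assms by (simp add: normal_form_def cubic_form_in_BC)
qed

lemma cardano_covariant_normal_form:
  fixes \<Delta> :: "'a::field"
  assumes "(2::'a) \<noteq> 0" "8 * k ^ 3 * (p\<^sup>2 + 27 * \<Delta> * w\<^sup>2) = 1"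
  shows "cardano_covariant \<Delta> (normal_form \<Delta> p w k) x y =
    res_elem \<Delta> p (3 * w) \<otimes>\<^bsub>resolvent_algebra \<Delta>\<^esub> res_elem \<Delta> x (k * y) [^]\<^bsub>res_units \<Delta>\<^esub> (3::nat)"
proof -
  \<comment> \<open>The coordinates of the cube of \<open>x\<close> +
    \<open>k\<close>\<delta>\<open>y\<close>.\<close>
  let ?P = "x ^ 3 - 9 * \<Delta> * x * (k * y)\<^sup>2" and ?Q = "3 * x\<^sup>2 * (k * y) - 3 * \<Delta> * (k * y) ^ 3"
  have "cov_val (2 * w) (2 * k * p) (- 18 * \<Delta> * k\<^sup>2 * w) (- 2 * \<Delta> * k ^ 3 * p) x y
      = 2 * ((8 * k ^ 3 * (p\<^sup>2 + 27 * \<Delta> * w\<^sup>2)) * (p * ?P - 3 * \<Delta> * (3 * w) * ?Q))"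
    unfolding cov0_def cov1_def cubic_val_def by Groebner_Basis.algebra
  then have "cov_val (2 * w) (2 * k * p) (- 18 * \<Delta> * k\<^sup>2 * w) (- 2 * \<Delta> * k ^ 3 * p) x y / 2
      = p * ?P - 3 * \<Delta> * (3 * w) * ?Q"
    using assms by simp
  moreover have "3 * cubic_val (2 * w) (2 * k * p) (- 18 * \<Delta> * k\<^sup>2 * w) (- 2 * \<Delta> * k ^ 3 * p) x y
      = 2 * (p * ?Q + 3 * w * ?P)"
    unfolding cubic_val_def by Groebner_Basis.algebra
  then have "3 * cubic_val (2 * w) (2 * k * p) (- 18 * \<Delta> * k\<^sup>2 * w) (- 2 * \<Delta> * k ^ 3 * p) x y / 2
      = p * ?Q + 3 * w * ?P"
    using assms(1) by (metis nonzero_mult_div_cancel_left)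
  ultimately show ?thesis
    unfolding normal_form_def cardano_covariant_cubic_form res_elem_cube res_elem_mult by (simp only:)
qed

text \<open>A factor \<epsilon>^3 of \<zeta> can be absorbed into the cube of the linear form. The
  resulting change of variables has determinant 1 exactly when the new parameter is
  \<open>k / N\<close>.\<close>

lemma normal_form_SL2:
  fixes \<Delta> :: "'a::field"
  assumes three: "(3::'a) \<noteq> 0" and k: "k \<noteq> 0" and N: "e\<^sup>2 + 3 * \<Delta> * f\<^sup>2 = N" "N \<noteq> 0"
    and z: "res_elem \<Delta> p' (3 * w') = res_elem \<Delta> p (3 * w) \<otimes>\<^bsub>resolvent_algebra \<Delta>\<^esub>
          res_elem \<Delta> e f [^]\<^bsub>res_units \<Delta>\<^esub> (3::nat)"
  shows "form_equiv SL2 (normal_form \<Delta> p w k) (normal_form \<Delta> p' w' (k / N))"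
proof -
  define l where "l = k / N"
  \<comment> \<open>With \<open>\<epsilon> = e + f\<delta>\<close>, the matrix substitutes the \<open>X\<close>, \<open>Y\<close> with \<open>\<epsilon>(x + l\<delta>y) = X + k\<delta>Y\<close>.\<close>
  define s u where "s = f / k" and "u = e / N"
  have ks: "k * s = f" and ku: "k * u = e * l"
    using k by (simp_all add: s_def u_def l_def)
  \<comment> \<open>Moving \<open>k\<close> into the second variable means that \<open>s\<close> and
    \<open>u\<close> occur only as \<open>k * s\<close> and \<open>k * u\<close>, which have no
    division by \<open>k\<close>.\<close>
  have scale: "cubic_val (2 * w) (2 * k * p) (- 18 * \<Delta> * k\<^sup>2 * w) (- 2 * \<Delta> * k ^ 3 * p) x y
      = cubic_val (2 * w) (2 * p) (- 18 * \<Delta> * w) (- 2 * \<Delta> * p) x (k * y)"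
    "cubic_polar (2 * w) (2 * k * p) (- 18 * \<Delta> * k\<^sup>2 * w) (- 2 * \<Delta> * k ^ 3 * p) x y v v'
      = cubic_polar (2 * w) (2 * p) (- 18 * \<Delta> * w) (- 2 * \<Delta> * p) x (k * y) v (k * v')" for x y v v'
    unfolding cubic_val_def cubic_polar_def by Groebner_Basis.algebra+
  have p': "p' = p * (e ^ 3 - 9 * \<Delta> * e * f\<^sup>2) - 3 * \<Delta> * (3 * w) * (3 * e\<^sup>2 * f - 3 * \<Delta> * f ^ 3)"
    and "3 * w' = p * (3 * e\<^sup>2 * f - 3 * \<Delta> * f ^ 3) + 3 * w * (e ^ 3 - 9 * \<Delta> * e * f\<^sup>2)"
    using z by (simp_all add: res_elem_cube res_elem_mult res_elem_inject)
  then have "3 * w' = 3 * (p * (e\<^sup>2 * f - \<Delta> * f ^ 3) + w * (e ^ 3 - 9 * \<Delta> * e * f\<^sup>2))"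
    by (simp add: algebra_simps)
  then have w': "w' = p * (e\<^sup>2 * f - \<Delta> * f ^ 3) + w * (e ^ 3 - 9 * \<Delta> * e * f\<^sup>2)"
    using three by (metis mult_cancel_left)
  have "e * u - s * (- 3 * \<Delta> * f * l) = (e\<^sup>2 + 3 * \<Delta> * f\<^sup>2) / N"
    using k by (simp add: s_def u_def l_def power2_eq_square add_divide_distrib)
  then have det: "e * u - s * (- 3 * \<Delta> * f * l) = 1"
    using N by simp
  have "cubic_val (2 * w) (2 * p) (- 18 * \<Delta> * w) (- 2 * \<Delta> * p) e f = 2 * w'"
    "cubic_polar (2 * w) (2 * p) (- 18 * \<Delta> * w) (- 2 * \<Delta> * p) e f (- 3 * \<Delta> * f * l) (e * l) = 2 * l * p'"
    "cubic_polar (2 * w) (2 * p) (- 18 * \<Delta> * w) (- 2 * \<Delta> * p) (- 3 * \<Delta> * f * l) (e * l) e f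
       = - 18 * \<Delta> * l\<^sup>2 * w'"
    "cubic_val (2 * w) (2 * p) (- 18 * \<Delta> * w) (- 2 * \<Delta> * p) (- 3 * \<Delta> * f * l) (e * l) = - 2 * \<Delta> * l ^ 3 * p'"
    unfolding cubic_val_def cubic_polar_def p' w' by Groebner_Basis.algebra+
  then show ?thesis
    using cubic_form_SL2[OF det, of "2 * w" "2 * k * p" "- 18 * \<Delta> * k\<^sup>2 * w" "- 2 * \<Delta> * k ^ 3 * p"]
    unfolding normal_form_def l_def[symmetric] scale ks ku by simp
qed

text \<open>Equal classes provide \<epsilon> with \<zeta>' = \<zeta>\<epsilon>^3. It remains to
  arrange that the norm of \<epsilon> is exactly \<open>k / k'\<close>, as
  \<open>normal_form_SL2\<close> demands.\<close>

lemma normal_form_equiv_of_cube_class_eq: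
  fixes \<Delta> :: "'a::field"
  assumes three: "(3::'a) \<noteq> 0"
    and 1: "8 * k ^ 3 * (p\<^sup>2 + 27 * \<Delta> * w\<^sup>2) = 1" and 2: "8 * k' ^ 3 * (p'\<^sup>2 + 27 * \<Delta> * w'\<^sup>2) = 1"
    and eq: "cube_class (res_units \<Delta>) (res_elem \<Delta> p' (3 * w')) = cube_class (res_units \<Delta>) (res_elem \<Delta> p (3 * w))"
  shows "form_equiv SL2 (normal_form \<Delta> p w k) (normal_form \<Delta> p' w' k')"
proof -
  have norm: "p\<^sup>2 + 3 * \<Delta> * (3 * w)\<^sup>2 = p\<^sup>2 + 27 * \<Delta> * w\<^sup>2" "p'\<^sup>2 + 3 * \<Delta> * (3 * w')\<^sup>2 = p'\<^sup>2 + 27 * \<Delta> * w'\<^sup>2"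
    by (simp_all add: power2_eq_square)
  have nz: "k \<noteq> 0" "k' \<noteq> 0" "p\<^sup>2 + 27 * \<Delta> * w\<^sup>2 \<noteq> 0" "p'\<^sup>2 + 27 * \<Delta> * w'\<^sup>2 \<noteq> 0"
    using 1 2 by auto
  then obtain e f where ef: "e\<^sup>2 + 3 * \<Delta> * f\<^sup>2 \<noteq> 0"
    and z: "res_elem \<Delta> p' (3 * w') = res_elem \<Delta> p (3 * w) \<otimes>\<^bsub>resolvent_algebra \<Delta>\<^esub>
          res_elem \<Delta> e f [^]\<^bsub>res_units \<Delta>\<^esub> (3::nat)"
    using eq res_cube_class_eq_iff[of p' \<Delta> "3 * w'" p "3 * w"] unfolding norm by blast
  define N where "N = e\<^sup>2 + 3 * \<Delta> * f\<^sup>2"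
  have "res_norm \<Delta> (res_elem \<Delta> p' (3 * w')) = res_norm \<Delta> (res_elem \<Delta> p (3 * w)) * N ^ 3"
    unfolding z using ef by (subst res_norm_mult)
      (simp add: res_elem_cube, simp add: res_elem_cube,
        simp add: N_def res_norm_cube res_elem_in_res_units res_norm_res_elem)
  then have n3: "p'\<^sup>2 + 27 * \<Delta> * w'\<^sup>2 = (p\<^sup>2 + 27 * \<Delta> * w\<^sup>2) * N ^ 3"
    unfolding res_norm_res_elem norm .
  \<comment> \<open>\<open>N(\<epsilon>)\<close> matches \<open>k / k'\<close> only up to a cube root of unity \<open>\<omega>\<close>; replacing \<open>\<epsilon>\<close> by \<open>\<omega>\<epsilon>\<close> corrects this.\<close>
  define \<omega> where "\<omega> = k' * N / k"
  have "8 * (p\<^sup>2 + 27 * \<Delta> * w\<^sup>2) * (k' * N) ^ 3 = 8 * (p\<^sup>2 + 27 * \<Delta> * w\<^sup>2) * k ^ 3"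
    using 1 2 unfolding n3 by Groebner_Basis.algebra
  moreover have "8 * (p\<^sup>2 + 27 * \<Delta> * w\<^sup>2) \<noteq> 0"
  proof
    assume 0: "8 * (p\<^sup>2 + 27 * \<Delta> * w\<^sup>2) = 0"
    have "8 * k ^ 3 * (p\<^sup>2 + 27 * \<Delta> * w\<^sup>2) = k ^ 3 * (8 * (p\<^sup>2 + 27 * \<Delta> * w\<^sup>2))"
      by (simp only: ac_simps)
    then show False unfolding 0 1 by simp
  qed
  ultimately have "(k' * N) ^ 3 = k ^ 3" by (metis mult_cancel_left)
  then have \<omega>: "\<omega> ^ 3 = 1" using nz by (simp add: \<omega>_def power_divide)
  then have "\<omega> \<noteq> 0" by auto
  have "res_elem \<Delta> (\<omega> * e) (\<omega> * f) [^]\<^bsub>res_units \<Delta>\<^esub> (3::nat)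
      = res_elem \<Delta> (\<omega> ^ 3 * (e ^ 3 - 9 * \<Delta> * e * f\<^sup>2)) (\<omega> ^ 3 * (3 * e\<^sup>2 * f - 3 * \<Delta> * f ^ 3))"
    by (simp add: res_elem_cube res_elem_inject power2_eq_square power3_eq_cube algebra_simps)
  also have "\<dots> = res_elem \<Delta> e f [^]\<^bsub>res_units \<Delta>\<^esub> (3::nat)"
    unfolding \<omega> by (simp add: res_elem_cube)
  finally have z': "res_elem \<Delta> p' (3 * w') = res_elem \<Delta> p (3 * w) \<otimes>\<^bsub>resolvent_algebra \<Delta>\<^esub>
          res_elem \<Delta> (\<omega> * e) (\<omega> * f) [^]\<^bsub>res_units \<Delta>\<^esub> (3::nat)"
    using z by simp
  have "k / (\<omega>\<^sup>2 * N) = k'"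
  proof -
    have "k / (\<omega>\<^sup>2 * N) = \<omega> ^ 3 * k / (\<omega>\<^sup>2 * N)" using \<omega> by simp
    also have "\<dots> = \<omega> * k / N" using \<open>\<omega> \<noteq> 0\<close> by (simp add: power3_eq_cube power2_eq_square)
    also have "\<dots> = k'" using nz ef by (simp add: \<omega>_def N_def)
    finally show ?thesis .
  qed
  moreover have "(\<omega> * e)\<^sup>2 + 3 * \<Delta> * (\<omega> * f)\<^sup>2 = \<omega>\<^sup>2 * N"
    by (simp add: N_def power_mult_distrib algebra_simps)
  ultimately show ?thesis
    using normal_form_SL2[OF three nz(1) _ _ z', of "\<omega>\<^sup>2 * N"] ef \<open>\<omega> \<noteq> 0\<close> by (simp add: N_def)
qed

lemma four_neq_zero: "(2::'a::field) \<noteq> 0 \<Longrightarrow> (4::'a) \<noteq> 0"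
  using mult_eq_0_iff[of "2::'a" 2] by simp

text \<open>The parameter \<zeta> is the Cardano covariant at \<open>(1, 0)\<close>, and the
  hypothesis that the Hessian is nonzero there allows completing its square.\<close>

lemma cubic_form_equiv_normal_form:
  fixes a b c d :: "'a::field"
  assumes two: "(2::'a) \<noteq> 0" and \<Delta>: "disc_coeffs a b c d = \<Delta>" and n: "b\<^sup>2 - 3 * a * c \<noteq> 0"
  obtains k where "8 * k ^ 3 * ((cov0 a b c d / 2)\<^sup>2 + 27 * \<Delta> * (a / 2)\<^sup>2) = 1"
    "form_equiv SL2 (cubic_form a b c d) (normal_form \<Delta> (cov0 a b c d / 2) (a / 2) k)"
proof -
  \<comment> \<open>\<open>n\<close> and \<open>m\<close> are the first two Hessian coefficients;
    the shear sending X to X - (\<open>m * k\<close>)Y removes the middle term.\<close>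
  define n where "n = b\<^sup>2 - 3 * a * c"
  define m where "m = b * c - 9 * a * d"
  define k where "k = inverse (2 * n)"
  have "n \<noteq> 0" using assms(3) by (simp add: n_def)
  then have nk: "2 * n * k = 1" using two by (simp add: k_def)
  note four = four_neq_zero[OF two]
  have "4 * ((cov0 a b c d / 2)\<^sup>2 + 27 * \<Delta> * (a / 2)\<^sup>2) = (cov0 a b c d)\<^sup>2 + 27 * \<Delta> * a\<^sup>2"
    using four by (simp add: power_divide field_simps)
  also have "\<dots> = 4 * n ^ 3"
    using cubic_syzygy[of a b c d 1 0] by (simp add: cubic_val_def hess_val_def \<Delta> n_def)
  finally have "(cov0 a b c d / 2)\<^sup>2 + 27 * \<Delta> * (a / 2)\<^sup>2 = n ^ 3"
    using four by (metis mult_cancel_left)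
  then have 1: "8 * k ^ 3 * ((cov0 a b c d / 2)\<^sup>2 + 27 * \<Delta> * (a / 2)\<^sup>2) = 1"
    using arg_cong[OF nk, of "\<lambda>x. x ^ 3"] by (simp add: power_mult_distrib ac_simps)
  \<comment> \<open>Factors \<open>2 * n * k\<close>, equal to 1, are inserted here and in the next
    two facts to make each side homogeneous in \<open>k\<close>; what remains is a polynomial
    identity free of side conditions.\<close>
  have 2: "cubic_polar a b c d 1 0 (- m * k) 1 = k * cov0 a b c d"
  proof -
    have "cubic_polar a b c d 1 0 (- m * k) 1 = b * (2 * n * k) - 3 * a * m * k"
      unfolding nk by (simp add: cubic_polar_def algebra_simps)
    also have "\<dots> = k * cov0 a b c d"
      unfolding n_def m_def cov0_def by Groebner_Basis.algebra
    finally show ?thesis .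
  qed
  have 3: "cubic_polar a b c d (- m * k) 1 1 0 = - 9 * \<Delta> * k\<^sup>2 * a"
  proof -
    have "cubic_polar a b c d (- m * k) 1 1 0 = 3 * a * (m * k)\<^sup>2 - 2 * b * m * k * (2 * n * k) + c * (2 * n * k)\<^sup>2"
      unfolding nk by (simp add: cubic_polar_def algebra_simps)
    also have "\<dots> = - 9 * \<Delta> * k\<^sup>2 * a"
      unfolding n_def m_def \<Delta>[symmetric] disc_coeffs_def by Groebner_Basis.algebra
    finally show ?thesis .
  qed
  have 4: "cubic_val a b c d (- m * k) 1 = - \<Delta> * k ^ 3 * cov0 a b c d"
  proof -
    have "cubic_val a b c d (- m * k) 1 = - (a * (m * k) ^ 3) + b * (m * k)\<^sup>2 * (2 * n * k)
        - c * m * k * (2 * n * k)\<^sup>2 + d * (2 * n * k) ^ 3"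
      unfolding nk by (simp add: cubic_val_def algebra_simps power3_eq_cube)
    also have "\<dots> = - \<Delta> * k ^ 3 * cov0 a b c d"
      unfolding n_def m_def \<Delta>[symmetric] disc_coeffs_def cov0_def by Groebner_Basis.algebra
    finally show ?thesis .
  qed
  have "normal_form \<Delta> (cov0 a b c d / 2) (a / 2) k
      = cubic_form (cubic_val a b c d 1 0) (cubic_polar a b c d 1 0 (- m * k) 1)
          (cubic_polar a b c d (- m * k) 1 1 0) (cubic_val a b c d (- m * k) 1)"
  proof -
    have "18 * (a / 2) = 9 * a" using two by (simp add: field_simps)
    then show ?thesis
      unfolding 2 3 4 normal_form_def using two by (simp add: cubic_val_def cubic_form_eq_pCons)
  qed
  then have "form_equiv SL2 (cubic_form a b c d) (normal_form \<Delta> (cov0 a b c d / 2) (a / 2) k)"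
    by (metis cubic_form_SL2 diff_zero mult_1 mult_zero_left)
  with 1 show ?thesis by (rule that)
qed


section \<open>The Cardano invariant\<close>

text \<open>On each class \<open>f\<close> is constant, so \<open>the_elem\<close> returns its
  value. Both orbit bijections are instances.\<close>

lemma bij_betw_quotient_image:
  "bij_betw (\<lambda>C. the_elem (f ` C)) (A // {(x, y). x \<in> A \<and> y \<in> A \<and> f x = f y}) (f ` A)"
proof -
  let ?r = "{(x, y). x \<in> A \<and> y \<in> A \<and> f x = f y}"
  have cls: "?r `` {x} = {y \<in> A. f y = f x}" if "x \<in> A" for x
    using that by auto
  have val: "the_elem (f ` (?r `` {x})) = f x" if "x \<in> A" for x
    unfolding cls[OF that] by (rule the_elem_image_unique) (use that in auto)
  show ?thesis
  proof (rule bij_betwI')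
    fix C D assume "C \<in> A // ?r" "D \<in> A // ?r"
    then obtain x y where "x \<in> A" "C = ?r `` {x}" "y \<in> A" "D = ?r `` {y}"
      by (auto elim!: quotientE)
    then show "the_elem (f ` C) = the_elem (f ` D) \<longleftrightarrow> C = D"
      using val cls by auto
  next
    fix C assume "C \<in> A // ?r"
    then obtain x where "x \<in> A" "C = ?r `` {x}" by (auto elim!: quotientE)
    then show "the_elem (f ` C) \<in> f ` A" using val by simp
  next
    fix z assume "z \<in> f ` A"
    then obtain x where "x \<in> A" "z = f x" by auto
    then show "\<exists>C\<in>A // ?r. z = the_elem (f ` C)"
      using val by (intro bexI[OF _ quotientI]) simp_all
  qed
qed

lemma BC_binary_cubic_forms: "g \<in> BC \<Delta> \<Longrightarrow> g \<in> binary_cubic_forms"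
  by (simp add: BC_def)

lemma twisted_act_in_BC:
  assumes "g \<in> BC \<Delta>" "(det M)\<^sup>2 = 1"
  shows "twisted_act g M \<in> BC \<Delta>"
proof -
  have "det M \<noteq> 0" using assms by auto
  then show ?thesis
    using assms by (auto simp: BC_def twisted_act_binary_cubic_forms cubic_disc_twisted_act)
qed

text \<open>A factor \<open>p\<close>X + \<open>q\<close>Y vanishes at \<open>(q, - p)\<close>;
  conversely a root \<open>(x, y)\<close> gives the factor \<open>y\<close>X - \<open>x\<close>Y, or
  Y when \<open>y = 0\<close>.\<close>

lemma has_linear_factor_iff_root:
  assumes "g \<in> binary_cubic_forms"
  shows "has_linear_factor g \<longleftrightarrow> (\<exists>x y. (x \<noteq> 0 \<or> y \<noteq> 0) \<and> beval g x y = 0)"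
proof
  assume "has_linear_factor g"
  then obtain p q h where pq: "(p, q) \<noteq> (0, 0)" and g: "g = (bconst p * bX + bconst q * bY) * h"
    unfolding has_linear_factor_def dvd_def by blast
  have "beval g q (- p) = 0"
    by (simp add: g beval_def bconst_def bX_def bY_def)
  then show "\<exists>x y. (x \<noteq> 0 \<or> y \<noteq> 0) \<and> beval g x y = 0"
    using pq by (intro exI[of _ q] exI[of _ "- p"]) auto
next
  assume "\<exists>x y. (x \<noteq> 0 \<or> y \<noteq> 0) \<and> beval g x y = 0"
  then obtain x y where xy: "x \<noteq> 0 \<or> y \<noteq> 0" and root: "beval g x y = 0" by auto
  obtain a b c d where g: "g = cubic_form a b c d"
    using assms by (auto simp: binary_cubic_forms_def)
  have lin: "bconst p * bX + bconst q * bY = [:[:0, p:], [:q:]:]" for p q :: 'a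
    by (simp add: bconst_def bX_def bY_def)
  show "has_linear_factor g"
  proof (cases "y = 0")
    case True
    then have "a = 0" using xy root by (simp add: g beval_cubic_form)
    then have "g = [:[:0, 0:], [:1:]:] * [:[:0, 0, b:], [:0, c:], [:d:]:]"
      by (simp add: g cubic_form_eq_pCons)
    then have "(bconst 0 * bX + bconst 1 * bY) dvd g"
      unfolding lin by (rule dvdI)
    moreover have "(0, 1) \<noteq> (0, 0 :: 'a)" by simp
    ultimately show ?thesis unfolding has_linear_factor_def by blast
  next
    case False
    \<comment> \<open>Synthetic division: \<alpha>, \<beta>, \<gamma> are the coefficients of the
      quotient by \<open>y\<close>X - \<open>x\<close>Y. The first three coefficients match by
      construction, and the root condition makes the last one match.\<close>
    define \<alpha> where "\<alpha> = a / y"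
    define \<beta> where "\<beta> = (b + x * \<alpha>) / y"
    define \<gamma> where "\<gamma> = (c + x * \<beta>) / y"
    have eqs: "y * \<alpha> = a" "y * \<beta> = b + x * \<alpha>" "y * \<gamma> = c + x * \<beta>"
      using False by (simp_all add: \<alpha>_def \<beta>_def \<gamma>_def)
    have "y ^ 3 * (d + x * \<gamma>) = d * y ^ 3 + y\<^sup>2 * x * (y * \<gamma>)"
      by Groebner_Basis.algebra
    also have "\<dots> = d * y ^ 3 + c * x * y\<^sup>2 + y * x\<^sup>2 * (y * \<beta>)"
      unfolding eqs(3) by Groebner_Basis.algebra
    also have "\<dots> = d * y ^ 3 + c * x * y\<^sup>2 + b * x\<^sup>2 * y + x ^ 3 * (y * \<alpha>)"
      unfolding eqs(2) by Groebner_Basis.algebra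
    also have "\<dots> = 0"
      using root unfolding eqs(1) by (simp add: g beval_cubic_form algebra_simps)
    finally have "- x * \<gamma> = d"
      using False by (simp add: add_eq_0_iff)
    then have "g = [:[:0, y:], [:- x:]:] * [:[:0, 0, \<alpha>:], [:0, \<beta>:], [:\<gamma>:]:]"
      using eqs by (simp add: g cubic_form_eq_pCons)
    then have "(bconst y * bX + bconst (- x) * bY) dvd g"
      unfolding lin by (rule dvdI)
    then show ?thesis unfolding has_linear_factor_def using False by blast
  qed
qed

section \<open>Well-definedness of the Cardano invariant\<close>

locale cardano =
  fixes \<Delta> :: "'a::field"
  assumes two: "(2::'a) \<noteq> 0" and three: "(3::'a) \<noteq> 0" and disc_nz: "\<Delta> \<noteq> 0"
begin

abbreviation z :: "'a poly poly \<Rightarrow> 'a poly set set" where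
  "z \<equiv> cardano_invariant \<Delta>"

abbreviation cl :: "'a \<Rightarrow> 'a \<Rightarrow> 'a poly set set" where
  "cl u v \<equiv> cube_class (res_units \<Delta>) (res_elem \<Delta> u v)"

lemma res_norm_cardano_covariant:
  assumes "disc_coeffs a b c d = \<Delta>"
  shows "res_norm \<Delta> (cardano_covariant \<Delta> (cubic_form a b c d) x y) = hess_val a b c d x y ^ 3"
proof -
  have "res_norm \<Delta> (cardano_covariant \<Delta> (cubic_form a b c d) x y)
      = ((cov_val a b c d x y)\<^sup>2 + 27 * \<Delta> * (cubic_val a b c d x y)\<^sup>2) / 4"
    by (simp add: cardano_covariant_cubic_form res_norm_res_elem power_divide power_mult_distrib add_divide_distrib)
  then show ?thesis
    using cubic_syzygy[of a b c d x y] assms four_neq_zero[OF two] by simp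
qed

lemma cardano_covariant_unit_iff:
  assumes "disc_coeffs a b c d = \<Delta>"
  shows "cardano_covariant \<Delta> (cubic_form a b c d) x y \<in> Units (resolvent_algebra \<Delta>)
    \<longleftrightarrow> hess_val a b c d x y \<noteq> 0"
  unfolding Units_resolvent_algebra res_norm_cardano_covariant[OF assms]
  by (simp add: cardano_covariant_cubic_form)

text \<open>The Hessian has discriminant -3\<Delta>, so it is not the zero form; if it vanishes at
  \<open>(1, 0)\<close> and \<open>(0, 1)\<close>, its value at \<open>(1, 1)\<close> is the middle
  coefficient.\<close>

lemma ex_cardano_covariant_unit:
  assumes "g \<in> BC \<Delta>"
  obtains x y where "cardano_covariant \<Delta> g x y \<in> Units (resolvent_algebra \<Delta>)"
proof -
  obtain a b c d where g: "g = cubic_form a b c d" "disc_coeffs a b c d = \<Delta>"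
    using assms by (rule BC_E)
  have "(b * c - 9 * a * d)\<^sup>2 - 4 * (b\<^sup>2 - 3 * a * c) * (c\<^sup>2 - 3 * b * d) = - 3 * disc_coeffs a b c d"
    unfolding disc_coeffs_def by Groebner_Basis.algebra
  then have "\<not> (b\<^sup>2 - 3 * a * c = 0 \<and> b * c - 9 * a * d = 0 \<and> c\<^sup>2 - 3 * b * d = 0)"
    using three disc_nz by (auto simp: g)
  then have "hess_val a b c d 1 0 \<noteq> 0 \<or> hess_val a b c d 0 1 \<noteq> 0 \<or> hess_val a b c d 1 1 \<noteq> 0"
    by (auto simp: hess_val_def)
  then show ?thesis
    using that cardano_covariant_unit_iff[OF g(2)] unfolding g(1) by blast
qed

text \<open>The parameter \<zeta> equals the given value of the covariant itself, not only its
  class; this precision lets values at two points be compared.\<close>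

lemma equiv_normal_form:
  assumes g: "g \<in> BC \<Delta>" and unit: "cardano_covariant \<Delta> g x y \<in> Units (resolvent_algebra \<Delta>)"
  obtains p w k where "8 * k ^ 3 * (p\<^sup>2 + 27 * \<Delta> * w\<^sup>2) = 1"
    "cardano_covariant \<Delta> g x y = res_elem \<Delta> p (3 * w)" "form_equiv SL2 g (normal_form \<Delta> p w k)"
proof -
  have "x \<noteq> 0 \<or> y \<noteq> 0"
  proof -
    obtain a b c d where "g = cubic_form a b c d" "disc_coeffs a b c d = \<Delta>"
      using g by (rule BC_E)
    then have "hess_val a b c d x y \<noteq> 0"
      using unit cardano_covariant_unit_iff by blast
    then show ?thesis by (auto simp: hess_val_def)
  qed
  then obtain t u where tu: "x * u - y * t = 1" by (rule SL2_first_row)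
  define M where "M = mat2 x y t u"
  have M: "det M = 1" "M \<in> SL2" using tu by (simp_all add: M_def SL2_def)
  then have "twisted_act g M \<in> BC \<Delta>" using g by (simp add: twisted_act_in_BC)
  then obtain a b c d where g': "twisted_act g M = cubic_form a b c d" "disc_coeffs a b c d = \<Delta>"
    by (rule BC_E)
  have C: "cardano_covariant \<Delta> (cubic_form a b c d) 1 0 = cardano_covariant \<Delta> g x y"
    using cardano_covariant_SL2[OF BC_binary_cubic_forms[OF g] M(2), of \<Delta> 1 0]
    by (simp add: M_def flip: g'(1))
  then have "hess_val a b c d 1 0 \<noteq> 0"
    using unit by (simp flip: cardano_covariant_unit_iff[OF g'(2)])
  then have "b\<^sup>2 - 3 * a * c \<noteq> 0" by (simp add: hess_val_def)
  then obtain k where k: "8 * k ^ 3 * ((cov0 a b c d / 2)\<^sup>2 + 27 * \<Delta> * (a / 2)\<^sup>2) = 1"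
    "form_equiv SL2 (cubic_form a b c d) (normal_form \<Delta> (cov0 a b c d / 2) (a / 2) k)"
    using cubic_form_equiv_normal_form[OF two g'(2)] by blast
  have "form_equiv SL2 g (cubic_form a b c d)"
    using M(2) g'(1)[symmetric] unfolding form_equiv_def by blast
  then have "form_equiv SL2 g (normal_form \<Delta> (cov0 a b c d / 2) (a / 2) k)"
    using k(2) BC_binary_cubic_forms[OF g] by (rule form_equiv_SL2_trans)
  moreover have "cardano_covariant \<Delta> g x y = res_elem \<Delta> (cov0 a b c d / 2) (3 * (a / 2))"
    unfolding C[symmetric] by (simp add: cardano_covariant_cubic_form cubic_val_def)
  ultimately show ?thesis using that k(1) by blast
qed

text \<open>In the normal form belonging to the first point, the value at any other point is \<zeta>
  times a cube.\<close>

lemma cube_class_cardano_covariant: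
  assumes g: "g \<in> BC \<Delta>"
    and unit: "cardano_covariant \<Delta> g x y \<in> Units (resolvent_algebra \<Delta>)"
    and unit': "cardano_covariant \<Delta> g x' y' \<in> Units (resolvent_algebra \<Delta>)"
  shows "cube_class (res_units \<Delta>) (cardano_covariant \<Delta> g x' y') = cube_class (res_units \<Delta>) (cardano_covariant \<Delta> g x y)"
proof -
  obtain p w k where pwk: "8 * k ^ 3 * (p\<^sup>2 + 27 * \<Delta> * w\<^sup>2) = 1"
    "cardano_covariant \<Delta> g x y = res_elem \<Delta> p (3 * w)" "form_equiv SL2 g (normal_form \<Delta> p w k)"
    using g unit by (rule equiv_normal_form)
  let ?h = "normal_form \<Delta> p w k"
  have h: "?h \<in> binary_cubic_forms" using normal_form_in_BC[OF pwk(1)] by (rule BC_binary_cubic_forms)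
  obtain M where M: "M \<in> SL2" "g = twisted_act ?h M"
    using form_equiv_SL2_sym[OF pwk(3) BC_binary_cubic_forms[OF g]] by (auto simp: form_equiv_def)
  obtain X Y where "cardano_covariant \<Delta> g x' y' = cardano_covariant \<Delta> ?h X Y"
    unfolding M(2) cardano_covariant_SL2[OF h M(1)] by blast
  then have C: "cardano_covariant \<Delta> g x' y' = res_elem \<Delta> p (3 * w) \<otimes>\<^bsub>resolvent_algebra \<Delta>\<^esub>
      res_elem \<Delta> X (k * Y) [^]\<^bsub>res_units \<Delta>\<^esub> (3::nat)"
    using cardano_covariant_normal_form[OF two pwk(1)] by simp
  \<comment> \<open>The cube must come from a unit: a zero norm would give the second covariant
    value norm zero.\<close>
  have "X\<^sup>2 + 3 * \<Delta> * (k * Y)\<^sup>2 \<noteq> 0"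
  proof
    assume 0: "X\<^sup>2 + 3 * \<Delta> * (k * Y)\<^sup>2 = 0"
    have "(X ^ 3 - 9 * \<Delta> * X * (k * Y)\<^sup>2)\<^sup>2 + 3 * \<Delta> * (3 * X\<^sup>2 * (k * Y) - 3 * \<Delta> * (k * Y) ^ 3)\<^sup>2
        = (X\<^sup>2 + 3 * \<Delta> * (k * Y)\<^sup>2) ^ 3"
      by Groebner_Basis.algebra
    then have "res_norm \<Delta> (cardano_covariant \<Delta> g x' y') = 0"
      unfolding C 0 by (subst res_norm_mult) (simp_all add: res_elem_cube res_norm_res_elem)
    then show False using unit' by (simp add: Units_resolvent_algebra)
  qed
  moreover have "p\<^sup>2 + 3 * \<Delta> * (3 * w)\<^sup>2 \<noteq> 0"
    using unit unfolding pwk(2) Units_resolvent_algebra res_norm_res_elem by simp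
  ultimately show ?thesis
    using C unfolding pwk(2) cardano_covariant_res_elem[of \<Delta> g x' y'] by (intro res_cube_class_eqI)
qed

lemma cardano_invariant_eq:
  assumes "g \<in> BC \<Delta>" "cardano_covariant \<Delta> g x y \<in> Units (resolvent_algebra \<Delta>)"
  shows "z g = cube_class (res_units \<Delta>) (cardano_covariant \<Delta> g x y)"
  unfolding cardano_invariant_def
  by (rule the_equality) (use assms cube_class_cardano_covariant in blast)+

lemma cardano_invariant_normal_form:
  assumes "8 * k ^ 3 * (p\<^sup>2 + 27 * \<Delta> * w\<^sup>2) = 1"
  shows "z (normal_form \<Delta> p w k) = cl p (3 * w)"
proof -
  have "cardano_covariant \<Delta> (normal_form \<Delta> p w k) 1 0 = res_elem \<Delta> p (3 * w)"
    by (simp add: cardano_covariant_normal_form[OF two assms] res_elem_cube res_elem_mult)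
  moreover have "res_elem \<Delta> p (3 * w) \<in> Units (resolvent_algebra \<Delta>)"
  proof -
    have "p\<^sup>2 + 27 * \<Delta> * w\<^sup>2 \<noteq> 0" using assms by auto
    moreover have "p\<^sup>2 + 3 * \<Delta> * (3 * w)\<^sup>2 = p\<^sup>2 + 27 * \<Delta> * w\<^sup>2" by (simp add: power2_eq_square)
    ultimately have "p\<^sup>2 + 3 * \<Delta> * (3 * w)\<^sup>2 \<noteq> 0" by metis
    then show ?thesis
      unfolding Units_resolvent_algebra res_norm_res_elem by simp
  qed
  ultimately show ?thesis
    using cardano_invariant_eq[OF normal_form_in_BC[OF assms], of 1 0] by simp
qed

section \<open>Invariance and the classification up to SL(2)\<close>

text \<open>Values of the transformed covariant are values of the original one at moved points, and
  any unit value computes the invariant.\<close>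

lemma cardano_invariant_SL2:
  assumes g: "g \<in> BC \<Delta>" and M: "M \<in> SL2"
  shows "z (twisted_act g M) = z g"
proof -
  have h: "twisted_act g M \<in> BC \<Delta>" using assms by (simp add: SL2_def twisted_act_in_BC)
  then obtain x y where "cardano_covariant \<Delta> (twisted_act g M) x y \<in> Units (resolvent_algebra \<Delta>)"
    by (rule ex_cardano_covariant_unit)
  then show ?thesis
    using cardano_invariant_eq[OF h] cardano_invariant_eq[OF g]
    unfolding cardano_covariant_SL2[OF BC_binary_cubic_forms[OF g] M] by simp
qed

lemma BC_normal_form:
  assumes "g \<in> BC \<Delta>"
  obtains p w k where "8 * k ^ 3 * (p\<^sup>2 + 27 * \<Delta> * w\<^sup>2) = 1"
    "z g = cl p (3 * w)" "form_equiv SL2 g (normal_form \<Delta> p w k)"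
proof -
  obtain x y where unit: "cardano_covariant \<Delta> g x y \<in> Units (resolvent_algebra \<Delta>)"
    using assms by (rule ex_cardano_covariant_unit)
  show ?thesis
    by (rule equiv_normal_form[OF assms unit])
       (rule that, simp_all add: cardano_invariant_eq[OF assms unit])
qed

lemma form_equiv_SL2_iff:
  assumes "g1 \<in> BC \<Delta>" "g2 \<in> BC \<Delta>"
  shows "form_equiv SL2 g1 g2 \<longleftrightarrow> z g1 = z g2"
proof
  assume "form_equiv SL2 g1 g2"
  then show "z g1 = z g2" using assms cardano_invariant_SL2 by (auto simp: form_equiv_def)
next
  assume eq: "z g1 = z g2"
  obtain p w k where 1: "8 * k ^ 3 * (p\<^sup>2 + 27 * \<Delta> * w\<^sup>2) = 1"
    "z g1 = cl p (3 * w)" "form_equiv SL2 g1 (normal_form \<Delta> p w k)"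
    using assms(1) by (rule BC_normal_form)
  obtain p' w' k' where 2: "8 * k' ^ 3 * (p'\<^sup>2 + 27 * \<Delta> * w'\<^sup>2) = 1"
    "z g2 = cl p' (3 * w')" "form_equiv SL2 g2 (normal_form \<Delta> p' w' k')"
    using assms(2) by (rule BC_normal_form)
  have "form_equiv SL2 (normal_form \<Delta> p w k) (normal_form \<Delta> p' w' k')"
    using 1 2 eq by (intro normal_form_equiv_of_cube_class_eq[OF three]) simp_all
  then have "form_equiv SL2 g1 (normal_form \<Delta> p' w' k')"
    using 1(3) form_equiv_SL2_trans BC_binary_cubic_forms[OF assms(1)] by blast
  moreover have "form_equiv SL2 (normal_form \<Delta> p' w' k') g2"
    using 2(3) form_equiv_SL2_sym BC_binary_cubic_forms[OF assms(2)] by blast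
  ultimately show "form_equiv SL2 g1 g2"
    using form_equiv_SL2_trans BC_binary_cubic_forms[OF assms(1)] by blast
qed

text \<open>At matching points the two covariant values are conjugate, and their common norm is the
  cube of a nonzero Hessian value.\<close>

lemma cardano_invariant_neg_det:
  assumes g: "g \<in> BC \<Delta>" and M: "det M = - 1"
  shows "twisted_act g M \<in> BC \<Delta>"
    and "z (twisted_act g M) = inv\<^bsub>mod_cubes (res_units \<Delta>)\<^esub> z g"
proof -
  show h: "twisted_act g M \<in> BC \<Delta>" using assms by (simp add: twisted_act_in_BC)
  then obtain x y where unit: "cardano_covariant \<Delta> (twisted_act g M) x y \<in> Units (resolvent_algebra \<Delta>)"
    by (rule ex_cardano_covariant_unit)
  define X Y where "X = M $ 1 $ 1 * x + M $ 2 $ 1 * y" and "Y = M $ 1 $ 2 * x + M $ 2 $ 2 * y"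
  define p q where "p = beval (cubic_covariant g) X Y / 2" and "q = 3 * beval g X Y / 2"
  have C: "cardano_covariant \<Delta> g X Y = res_elem \<Delta> p q"
    by (simp add: cardano_covariant_res_elem p_def q_def)
  have C': "cardano_covariant \<Delta> (twisted_act g M) x y = res_elem \<Delta> p (- q)"
    using cardano_covariant_twisted_act[OF BC_binary_cubic_forms[OF g] M, of \<Delta> x y]
    by (simp add: p_def q_def X_def Y_def)
  have unit': "cardano_covariant \<Delta> g X Y \<in> Units (resolvent_algebra \<Delta>)"
    using unit unfolding C C' Units_resolvent_algebra res_norm_res_elem by simp
  obtain a b c d where abcd: "g = cubic_form a b c d" "disc_coeffs a b c d = \<Delta>"
    using g by (rule BC_E)
  then have "p\<^sup>2 + 3 * \<Delta> * q\<^sup>2 = hess_val a b c d X Y ^ 3"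
    using res_norm_cardano_covariant[OF abcd(2), of X Y] C by (simp add: res_norm_res_elem)
  moreover have "hess_val a b c d X Y \<noteq> 0"
    using unit' cardano_covariant_unit_iff[OF abcd(2)] abcd(1) by blast
  ultimately show "z (twisted_act g M) = inv\<^bsub>mod_cubes (res_units \<Delta>)\<^esub> z g"
    using cardano_invariant_eq[OF h unit] cardano_invariant_eq[OF g unit'] C C'
    by (simp add: inv_res_cube_class)
qed

section \<open>The image of the invariant and its trivial value\<close>

text \<open>The normalization of the normal form exhibits N(\<zeta>) as the cube of
  \<open>inverse (2 * k)\<close>.\<close>

lemma cardano_invariant_in_norm_one_group:
  assumes "g \<in> BC \<Delta>"
  shows "z g \<in> carrier (norm_one_group \<Delta>)"
proof -
  obtain p w k where k: "8 * k ^ 3 * (p\<^sup>2 + 27 * \<Delta> * w\<^sup>2) = 1" and zg: "z g = cl p (3 * w)"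
    using assms by (rule BC_normal_form)
  have "(2 * k) ^ 3 * (p\<^sup>2 + 3 * \<Delta> * (3 * w)\<^sup>2) = 8 * k ^ 3 * (p\<^sup>2 + 27 * \<Delta> * w\<^sup>2)"
    by Groebner_Basis.algebra
  then have 1: "(2 * k) ^ 3 * (p\<^sup>2 + 3 * \<Delta> * (3 * w)\<^sup>2) = 1"
    unfolding k .
  have "k \<noteq> 0" using k by auto
  then have nz: "inverse (2 * k) \<noteq> 0" using two by simp
  have "p\<^sup>2 + 3 * \<Delta> * (3 * w)\<^sup>2 = inverse (2 * k) ^ 3"
    using inverse_unique[OF 1] by (simp only: power_inverse)
  with nz have "\<exists>n. n \<noteq> 0 \<and> p\<^sup>2 + 3 * \<Delta> * (3 * w)\<^sup>2 = n ^ 3"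
    by blast
  then show ?thesis
    unfolding carrier_norm_one_group zg by blast
qed

text \<open>For surjectivity, a representative of norm \<open>n ^ 3\<close> serves as \<zeta>, and
  \<open>k = inverse (2 * n)\<close> meets the normalization.\<close>

lemma cardano_invariant_image: "z ` BC \<Delta> = carrier (norm_one_group \<Delta>)"
proof (intro equalityI subsetI)
  fix Z assume "Z \<in> carrier (norm_one_group \<Delta>)"
  then obtain p q n where Z: "Z = cl p q" "n \<noteq> 0" "p\<^sup>2 + 3 * \<Delta> * q\<^sup>2 = n ^ 3"
    by (auto simp: carrier_norm_one_group)
  define w where "w = q / 3"
  define k where "k = inverse (2 * n)"
  have q: "q = 3 * w" using three by (simp add: w_def)
  have nk: "2 * k * n = 1" using two Z(2) by (simp add: k_def)
  have "8 * k ^ 3 * (p\<^sup>2 + 27 * \<Delta> * w\<^sup>2) = 8 * k ^ 3 * (p\<^sup>2 + 3 * \<Delta> * q\<^sup>2)"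
    unfolding q by Groebner_Basis.algebra
  also have "\<dots> = (2 * k * n) ^ 3"
    unfolding Z(3) by Groebner_Basis.algebra
  finally have k: "8 * k ^ 3 * (p\<^sup>2 + 27 * \<Delta> * w\<^sup>2) = 1"
    unfolding nk by simp
  show "Z \<in> z ` BC \<Delta>"
    using cardano_invariant_normal_form[OF k] normal_form_in_BC[OF k] Z(1) q by force
qed (use cardano_invariant_in_norm_one_group in auto)

lemma cardano_invariant_eq_one_iff:
  assumes g: "g \<in> BC \<Delta>"
  shows "z g = \<one>\<^bsub>mod_cubes (res_units \<Delta>)\<^esub> \<longleftrightarrow> has_linear_factor g"
proof -
  have one: "\<one>\<^bsub>mod_cubes (res_units \<Delta>)\<^esub> = cl 1 0"
    by (simp add: comm_group.one_mod_cubes[OF comm_group_res_units] one_res_units)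
  note gb = BC_binary_cubic_forms[OF g]
  show ?thesis
    unfolding one has_linear_factor_iff_root[OF gb]
  proof
    assume zg: "z g = cl 1 0"
    \<comment> \<open>For \<zeta> = 1 the normalization holds with \<open>k\<close> equal to 1/2,
      and the leading coefficient of this normal form is zero.\<close>
    define k :: 'a where "k = inverse 2"
    let ?h = "normal_form \<Delta> 1 0 k"
    have "2 * k = 1" using two by (simp add: k_def)
    moreover have "8 * k ^ 3 = (2 * k) ^ 3" by Groebner_Basis.algebra
    ultimately have k: "8 * k ^ 3 * (1\<^sup>2 + 27 * \<Delta> * 0\<^sup>2) = 1" by simp
    have "form_equiv SL2 g ?h"
      using form_equiv_SL2_iff[OF g normal_form_in_BC[OF k]] cardano_invariant_normal_form[OF k] zg
      by simp
    then obtain M where M: "det M = 1" "?h = twisted_act g M"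
      by (auto simp: form_equiv_def SL2_def)
    have "beval ?h 1 0 = 0"
      by (simp add: normal_form_def beval_cubic_form)
    then have "beval g (M $ 1 $ 1) (M $ 1 $ 2) = 0"
      using beval_twisted_act[OF gb, of M 1 0] M by simp
    moreover have "M $ 1 $ 1 \<noteq> 0 \<or> M $ 1 $ 2 \<noteq> 0"
      using M(1) by (auto simp: det_2)
    ultimately show "\<exists>x y. (x \<noteq> 0 \<or> y \<noteq> 0) \<and> beval g x y = 0" by blast
  next
    assume "\<exists>x y. (x \<noteq> 0 \<or> y \<noteq> 0) \<and> beval g x y = 0"
    then obtain x y where "x \<noteq> 0 \<or> y \<noteq> 0" and root: "beval g x y = 0" by blast
    then obtain t u where tu: "x * u - y * t = 1" using SL2_first_row by metis
    define M where "M = mat2 x y t u"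
    have M: "det M = 1" "M \<in> SL2" using tu by (simp_all add: M_def SL2_def)
    then have h: "twisted_act g M \<in> BC \<Delta>" using g by (simp add: twisted_act_in_BC)
    then obtain a b c d where g': "twisted_act g M = cubic_form a b c d" "disc_coeffs a b c d = \<Delta>"
      by (rule BC_E)
    have "beval (twisted_act g M) 1 0 = 0"
      using root unfolding beval_twisted_act[OF gb] by (simp add: M_def)
    \<comment> \<open>With \<open>a = 0\<close> the discriminant is divisible by \<open>b\<close>^2,
      so \<open>b\<close> is nonzero, and the covariant at \<open>(1, 0)\<close> is the cube of
      \<open>b\<close>.\<close>
    then have a: "a = 0" by (simp add: g' beval_cubic_form)
    then have b: "b \<noteq> 0" using g'(2) disc_nz by (auto simp: disc_coeffs_def)
    have C: "cardano_covariant \<Delta> (twisted_act g M) 1 0 = res_elem \<Delta> (b ^ 3) 0"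
      using two by (simp add: g' a cardano_covariant_cubic_form cubic_val_def cov0_def)
    have "z g = z (twisted_act g M)"
      using g M(2) by (simp add: cardano_invariant_SL2)
    also have "\<dots> = cl (b ^ 3) 0"
      using cardano_invariant_eq[OF h, of 1 0] b unfolding C by (simp add: Units_resolvent_algebra res_norm_res_elem)
    also have "\<dots> = cl 1 0"
      using b by (intro res_cube_class_eqI[where e = b and f = 0]) (simp_all add: res_elem_cube res_elem_mult)
    finally show "z g = cl 1 0" .
  qed
qed

section \<open>Classification up to GL(2) and the orbit bijections\<close>

lemma form_equiv_GL2_iff:
  assumes g1: "g1 \<in> BC \<Delta>" and g2: "g2 \<in> BC \<Delta>"
  shows "form_equiv GL2 g1 g2 \<longleftrightarrow> z g1 = z g2 \<or> z g1 = inv\<^bsub>mod_cubes (res_units \<Delta>)\<^esub> z g2"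
proof
  assume "form_equiv GL2 g1 g2"
  then obtain M where M: "det M \<noteq> 0" "g2 = twisted_act g1 M"
    by (auto simp: form_equiv_def GL2_iff)
  \<comment> \<open>Both discriminants equal the nonzero \<Delta>, so the scaling law leaves only
    determinants 1 and -1.\<close>
  then have "\<Delta> = (det M)\<^sup>2 * \<Delta>"
    using cubic_disc_twisted_act[of g1 M] g1 g2 by (simp add: BC_def)
  then have "(det M)\<^sup>2 = 1" using disc_nz by simp
  then consider "det M = 1" | "det M = - 1" by (auto simp: power2_eq_1_iff)
  then show "z g1 = z g2 \<or> z g1 = inv\<^bsub>mod_cubes (res_units \<Delta>)\<^esub> z g2"
  proof cases
    case 1
    then show ?thesis using cardano_invariant_SL2[OF g1] M by (simp add: SL2_def)
  next
    case 2
    interpret LM: comm_group "mod_cubes (res_units \<Delta>)"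
      by (rule comm_group.comm_group_mod_cubes[OF comm_group_res_units])
    have "z g1 \<in> carrier (mod_cubes (res_units \<Delta>))"
      using cardano_invariant_in_norm_one_group[OF g1] subgroup.mem_carrier[OF subgroup_norm_one_group] by blast
    then show ?thesis using cardano_invariant_neg_det(2)[OF g1 2] M by simp
  qed
next
  assume "z g1 = z g2 \<or> z g1 = inv\<^bsub>mod_cubes (res_units \<Delta>)\<^esub> z g2"
  then show "form_equiv GL2 g1 g2"
  proof
    assume "z g1 = z g2"
    then have "form_equiv SL2 g1 g2" using form_equiv_SL2_iff[OF g1 g2] by simp
    then show ?thesis by (auto simp: form_equiv_def SL2_def GL2_iff)
  next
    assume inv: "z g1 = inv\<^bsub>mod_cubes (res_units \<Delta>)\<^esub> z g2"
    \<comment> \<open>A determinant -1 involution: it carries \<open>g2\<close> to a form with the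
      invariant of \<open>g1\<close> and then brings that form back.\<close>
    define N :: "'a^2^2" where "N = mat2 1 0 0 (- 1)"
    have N: "det N = - 1" "N \<in> GL2" by (simp_all add: N_def GL2_iff)
    note h = cardano_invariant_neg_det[OF g2 N(1)]
    have "form_equiv SL2 g1 (twisted_act g2 N)"
      using form_equiv_SL2_iff[OF g1 h(1)] h(2) inv by simp
    then have "form_equiv GL2 g1 (twisted_act g2 N)"
      by (auto simp: form_equiv_def SL2_def GL2_iff)
    moreover have "N ** N = mat 1"
      by (simp add: N_def vec_eq_iff forall_2 matrix_matrix_mult_def sum_2 mat_def)
    then have "g2 = twisted_act (twisted_act g2 N) N"
      using g2 by (simp add: twisted_act_twisted_act twisted_act_mat_1 BC_binary_cubic_forms)
    then have "form_equiv GL2 (twisted_act g2 N) g2"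
      using N(2) by (auto simp: form_equiv_def)
    ultimately show ?thesis
      using form_equiv_trans[OF _ _ BC_binary_cubic_forms[OF g1] GL2_mult] by blast
  qed
qed

lemma cardano_invariant_cube:
  assumes "g \<in> BC \<Delta>"
  shows "z g \<in> carrier (mod_cubes (res_units \<Delta>))"
    and "z g \<otimes>\<^bsub>mod_cubes (res_units \<Delta>)\<^esub> z g \<otimes>\<^bsub>mod_cubes (res_units \<Delta>)\<^esub> z g = \<one>\<^bsub>mod_cubes (res_units \<Delta>)\<^esub>"
proof -
  show "z g \<in> carrier (mod_cubes (res_units \<Delta>))"
    using cardano_invariant_in_norm_one_group[OF assms] subgroup.mem_carrier[OF subgroup_norm_one_group] by blast
  then show "z g \<otimes>\<^bsub>mod_cubes (res_units \<Delta>)\<^esub> z g \<otimes>\<^bsub>mod_cubes (res_units \<Delta>)\<^esub> z g = \<one>\<^bsub>mod_cubes (res_units \<Delta>)\<^esub>"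
    by (rule comm_group.mod_cubes_cube[OF comm_group_res_units])
qed

lemma form_equiv_GL2_iff_generate:
  assumes "g1 \<in> BC \<Delta>" "g2 \<in> BC \<Delta>"
  shows "form_equiv GL2 g1 g2 \<longleftrightarrow>
    generate (mod_cubes (res_units \<Delta>)) {z g1} = generate (mod_cubes (res_units \<Delta>)) {z g2}"
proof -
  interpret LM: comm_group "mod_cubes (res_units \<Delta>)"
    by (rule comm_group.comm_group_mod_cubes[OF comm_group_res_units])
  show ?thesis
    using form_equiv_GL2_iff[OF assms] LM.generate_eq_iff_exponent_three cardano_invariant_cube assms by metis
qed

lemma bij_betw_SL2_orbits:
  "bij_betw (\<lambda>orb. the_elem (z ` orb)) (orbits_on_BC SL2 \<Delta>) (carrier (norm_one_group \<Delta>))"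
proof -
  have "{(g1, g2). g1 \<in> BC \<Delta> \<and> g2 \<in> BC \<Delta> \<and> form_equiv SL2 g1 g2}
      = {(g1, g2). g1 \<in> BC \<Delta> \<and> g2 \<in> BC \<Delta> \<and> z g1 = z g2}"
    using form_equiv_SL2_iff by blast
  then show ?thesis
    using bij_betw_quotient_image[of z "BC \<Delta>"] unfolding orbits_on_BC_def cardano_invariant_image by simp
qed

text \<open>GL(2)-equivalence is the kernel relation of the map sending \<open>g\<close> to the
  subgroup generated by \<open>z g\<close>. Since \<open>z\<close> is onto the norm-one group, every
  cyclic subgroup arises.\<close>

lemma bij_betw_GL2_orbits:
  "bij_betw (\<lambda>orb. the_elem ((\<lambda>g. generate (mod_cubes (res_units \<Delta>)) {z g}) ` orb))
     (orbits_on_BC GL2 \<Delta>) (cyclic_subgroups (norm_one_group \<Delta>))"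
proof -
  let ?G = "mod_cubes (res_units \<Delta>)" and ?N = "norm_one_group \<Delta>"
  interpret LM: comm_group ?G
    by (rule comm_group.comm_group_mod_cubes[OF comm_group_res_units])
  have N: "?N = ?G\<lparr>carrier := carrier ?N\<rparr>"
    by (simp add: norm_one_group_def)
  have "group ?N"
    using LM.subgroup_imp_group[OF subgroup_norm_one_group] N by metis
  then have "cyclic_subgroups ?N = (\<lambda>x. generate ?N {x}) ` carrier ?N"
    by (rule group.cyclic_subgroups_eq)
  \<comment> \<open>Generation inside the norm-one subgroup agrees with generation in the full
    quotient.\<close>
  also have "\<dots> = (\<lambda>x. generate ?G {x}) ` carrier ?N"
  proof (rule image_cong[OF refl])
    fix x assume "x \<in> carrier ?N"
    then have "generate (?G\<lparr>carrier := carrier ?N\<rparr>) {x} = generate ?G {x}"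
      by (intro LM.generate_consistent subgroup_norm_one_group) simp
    then show "generate ?N {x} = generate ?G {x}" using N by simp
  qed
  also have "\<dots> = (\<lambda>g. generate ?G {z g}) ` BC \<Delta>"
    by (simp add: image_image flip: cardano_invariant_image)
  finally have cyc: "cyclic_subgroups ?N = (\<lambda>g. generate ?G {z g}) ` BC \<Delta>" .
  have "{(g1, g2). g1 \<in> BC \<Delta> \<and> g2 \<in> BC \<Delta> \<and> form_equiv GL2 g1 g2}
      = {(g1, g2). g1 \<in> BC \<Delta> \<and> g2 \<in> BC \<Delta> \<and> generate ?G {z g1} = generate ?G {z g2}}"
    using form_equiv_GL2_iff_generate by blast
  then show ?thesis
    using bij_betw_quotient_image[of "\<lambda>g. generate ?G {z g}" "BC \<Delta>"] unfolding orbits_on_BC_def cyc by simp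
qed

end

text \<open>If a prime vanishes in the field, the characteristic divides it, hence equals it, as a
  field does not have characteristic 1.\<close>

lemma numeral_neq_0_if_CHAR:
  assumes "CHAR('a::field) \<noteq> 2" "CHAR('a) \<noteq> 3"
  shows "(2::'a) \<noteq> 0" "(3::'a) \<noteq> 0"
proof -
  have *: "(of_nat p :: 'a) \<noteq> 0" if "prime p" "CHAR('a) \<noteq> p" for p :: nat
    using that by (auto simp: of_nat_eq_0_iff_char_dvd prime_nat_iff)
  show "(2::'a) \<noteq> 0" "(3::'a) \<noteq> 0"
    using *[of 2] *[of 3] assms by simp_all
qed

theorem theorem1p1:
  fixes \<Delta> :: "'a::field"
  assumes "CHAR('a) \<noteq> 2" and "CHAR('a) \<noteq> 3" and "\<Delta> \<noteq> 0"
  shows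
    "(\<forall>g\<in>BC \<Delta>. cardano_invariant \<Delta> g \<in> carrier (norm_one_group \<Delta>)) \<and>
     (\<forall>g\<in>BC \<Delta>. cardano_invariant \<Delta> g = \<one>\<^bsub>mod_cubes (res_units \<Delta>)\<^esub> \<longleftrightarrow> has_linear_factor g) \<and>
     (\<forall>g1\<in>BC \<Delta>. \<forall>g2\<in>BC \<Delta>.
        form_equiv SL2 g1 g2 \<longleftrightarrow> cardano_invariant \<Delta> g1 = cardano_invariant \<Delta> g2) \<and>
     (\<forall>g1\<in>BC \<Delta>. \<forall>g2\<in>BC \<Delta>.
        (form_equiv GL2 g1 g2 \<longleftrightarrow>
           cardano_invariant \<Delta> g1 = cardano_invariant \<Delta> g2 \<or>
           cardano_invariant \<Delta> g1 = inv\<^bsub>mod_cubes (res_units \<Delta>)\<^esub> (cardano_invariant \<Delta> g2)) \<and>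
        (form_equiv GL2 g1 g2 \<longleftrightarrow>
           generate (mod_cubes (res_units \<Delta>)) {cardano_invariant \<Delta> g1} =
           generate (mod_cubes (res_units \<Delta>)) {cardano_invariant \<Delta> g2})) \<and>
     bij_betw (\<lambda>orb. the_elem (cardano_invariant \<Delta> ` orb))
       (orbits_on_BC SL2 \<Delta>) (carrier (norm_one_group \<Delta>)) \<and>
     bij_betw (\<lambda>orb. the_elem ((\<lambda>g. generate (mod_cubes (res_units \<Delta>)) {cardano_invariant \<Delta> g}) ` orb))
       (orbits_on_BC GL2 \<Delta>) (cyclic_subgroups (norm_one_group \<Delta>))"
proof -
  interpret cardano \<Delta>
    using numeral_neq_0_if_CHAR[OF assms(1,2)] assms(3) by unfold_locales
  show ?thesis
    by (intro conjI ballI bij_betw_SL2_orbits bij_betw_GL2_orbits)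
       (rule cardano_invariant_in_norm_one_group cardano_invariant_eq_one_iff form_equiv_SL2_iff
         form_equiv_GL2_iff form_equiv_GL2_iff_generate; assumption)+
qed

end
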